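(* Let $r$ be a positive integer, let $\sigma=(\sigma_1,\ldots,\sigma_s)\in H_r$, let $\ell=|\sigma|$, and set $\rho=(r^\ell)$. Then $$c^{\rho^\vee}_{\underbrace{\sigma^\vee,\ldots,\sigma^\vee}_{r\text{ copies}}}>0.$$
   Context: A Young diagram is a finite weakly decreasing sequence $\sigma=(\sigma_1,\ldots,\sigma_s)$ of positive integers (row lengths), $|\sigma|=\sum_i\sigma_i$, and its dual $\sigma^\vee$ is given by $\sigma^\vee_j=\#\{i:\sigma_i\geq j\}$. $H_r$ is the set of Young diagrams with at most $r$ columns (i.e. $\sigma_1\leq r$). $(r^\ell)$ is the rectangular diagram with $\ell$ rows of length $r$, so $\rho^\vee=(\ell^r)$. The iterated Littlewood–Richardson coefficients $c^{\lambda}_{\mu^{(1)},\ldots,\mu^{(q)}}$ are defined, for diagrams with at most $r$ rows, by the expansion of products of Schur polynomials in $r$ variables: $\prod_{i=1}^q s_{\mu^{(i)}}(x_1,\ldots,x_r)=\sum_\lambda c^{\lambda}_{\mu^{(1)},\ldots,\mu^{(q)}}s_\lambda(x_1,\ldots,x_r)$, the sum over diagrams $\lambda$ with at most $r$ rows. *)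

theory Defs
  imports Complex_Main "HOL-Library.Poly_Mapping" "HOL-Library.FuncSet"
begin

definition young_diagram :: "nat list \<Rightarrow> bool" where
  "young_diagram \<sigma> \<longleftrightarrow> sorted_wrt (\<ge>) \<sigma> \<and> (\<forall>x\<in>set \<sigma>. 0 < x)"

definition num_cols :: "nat list \<Rightarrow> nat" where
  "num_cols \<sigma> = (if \<sigma> = [] then 0 else hd \<sigma>)"

definition H :: "nat \<Rightarrow> nat list set" where
  "H r = {\<sigma>. young_diagram \<sigma> \<and> num_cols \<sigma> \<le> r}"

(* List positions count from 0, column numbers j from 1. *)
definition young_dual :: "nat list \<Rightarrow> nat list" where
  "young_dual \<sigma> = map (\<lambda>j. card {i. i < length \<sigma> \<and> j \<le> \<sigma> ! i}) [1..<Suc (num_cols \<sigma>)]"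

definition rect :: "nat \<Rightarrow> nat \<Rightarrow> nat list" where
  "rect r l = replicate l r"

(* A monomial is its finitely supported exponent function, a polynomial a finitely
   supported integer-valued function on monomials; the product is convolution. *)
type_synonym mpoly = "(nat \<Rightarrow>\<^sub>0 nat) \<Rightarrow>\<^sub>0 int"

definition var :: "nat \<Rightarrow> mpoly" where
  "var i = Poly_Mapping.single (Poly_Mapping.single i 1) 1"

definition cells :: "nat list \<Rightarrow> (nat \<times> nat) set" where
  "cells \<nu> = {(i, j). i < length \<nu> \<and> j < \<nu> ! i}"

(* Semistandard tableaux with entries 1, ..., r. The extensional function space fixes
   the value off the diagram, so that each tableau is counted once. *)
definition ssyt :: "nat \<Rightarrow> nat list \<Rightarrow> (nat \<times> nat \<Rightarrow> nat) set" where
  "ssyt r \<nu> = {T \<in> cells \<nu> \<rightarrow>\<^sub>E {1..r}.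
     (\<forall>i j. (i, j) \<in> cells \<nu> \<and> (i, Suc j) \<in> cells \<nu> \<longrightarrow> T (i, j) \<le> T (i, Suc j)) \<and>
     (\<forall>i j. (i, j) \<in> cells \<nu> \<and> (Suc i, j) \<in> cells \<nu> \<longrightarrow> T (i, j) < T (Suc i, j))}"

definition schur :: "nat \<Rightarrow> nat list \<Rightarrow> mpoly" where
  "schur r \<nu> = (\<Sum>T\<in>ssyt r \<nu>. \<Prod>b\<in>cells \<nu>. var (T b))"

definition schur_expansion :: "nat \<Rightarrow> mpoly \<Rightarrow> (nat list \<Rightarrow> int) \<Rightarrow> bool" where
  "schur_expansion r p c \<longleftrightarrow>
     finite {\<nu>. c \<nu> \<noteq> 0} \<and>
     (\<forall>\<nu>. c \<nu> \<noteq> 0 \<longrightarrow> young_diagram \<nu> \<and> length \<nu> \<le> r) \<and>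
     p = (\<Sum>\<nu> | c \<nu> \<noteq> 0. of_int (c \<nu>) * schur r \<nu>)"

(* The description is proper: the schur r \<nu> with length \<nu> \<le> r form a basis of
   the symmetric polynomials in r variables over the integers. *)
definition lr_coeff :: "nat \<Rightarrow> nat list list \<Rightarrow> nat list \<Rightarrow> int" where
  "lr_coeff r \<mu>s = (THE c. schur_expansion r (\<Prod>\<mu>\<leftarrow>\<mu>s. schur r \<mu>) c)"

end

theory Submission
  imports Defs "HOL-Combinatorics.Permutations"
begin

text \<open>
Write \<open>x\<^sub>1, \<dots>, x\<^sub>r\<close> for the variables, \<open>\<delta> = (r - 1, \<dots>, 1, 0)\<close> and \<open>a(\<alpha>)\<close> for the
  alternant \<open>\<Sum>w. sgn w \<cdot> x\<^bsup>\<alpha> \<circ> w\<^esup>\<close>, the sum over the permutations of the indices. The argument has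
  two halves: a Littlewood-Richardson rule that counts tableaux, and tableaux that it counts.

  The rule is proved as in Stembridge's concise proof. For a weakly decreasing weight \<open>\<kappa>\<close>, the
  symmetry of \<open>s\<^sub>\<mu>\<close> gives \<open>a(\<kappa> + \<delta>) s\<^sub>\<mu> = \<Sum>T. a(\<kappa> + wt T + \<delta>)\<close> over the semistandard tableaux of
  shape \<open>\<mu>\<close>. The tableaux for which \<open>\<kappa>\<close> plus the content of some block of final columns fails
  to be weakly decreasing cancel in pairs: a Bender-Knuth involution on the columns to the left
  of the last failure exchanges two consecutive entries of \<open>\<kappa> + wt T + \<delta>\<close>. Only the
  \<open>\<kappa>\<close>-good tableaux survive (\<open>altd_times_schur\<close>). For \<open>\<kappa> = 0\<close> there is exactly one of them, so
  \<open>a(\<delta>) s\<^sub>\<nu> = a(\<nu> + \<delta>)\<close> (\<open>altd_zero_times_schur\<close>). Since \<open>a(\<delta>)\<close> is not a zero divisor and the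
  leading terms of the alternants \<open>a(\<nu> + \<delta>)\<close> differ, a Schur expansion is unique, and a product
  of Schur polynomials has one whose coefficients count chains of good tableaux
  (\<open>schur_expansion_unique\<close>, \<open>schur_expansion_of_altd_sum\<close>). It is therefore enough to exhibit
  one chain of \<open>r\<close> good tableaux of shape \<open>\<mu> = \<sigma>\<^sup>\<or>\<close> that leads from weight \<open>0\<close> to the weight
  \<open>(\<ell>, \<dots>, \<ell>)\<close>.

  For a single column of height \<open>h \<le> r\<close> such a chain is easy: let the weight after \<open>k\<close> steps be
  the most even distribution of \<open>k h\<close> units over \<open>r\<close> places. It is weakly decreasing, every step
  raises exactly \<open>h\<close> of the places by one, and after \<open>r\<close> steps all entries are \<open>h\<close>. The columns
  of \<open>\<mu>\<close> have heights \<open>\<sigma>\<^sub>1, \<dots>, \<sigma>\<^sub>s\<close>. The chains for these heights are superposed: the \<open>i\<close>-th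
  row of the \<open>k\<close>-th tableau collects the \<open>i\<close>-th smallest entries of the \<open>s\<close> columns used in
  step \<open>k\<close>. Goodness survives the superposition because, when read row by row, it is a linear
  condition on the numbers of entries in the rows (\<open>row_good_imp_good\<close>, \<open>strips_good\<close>).

  Tableaux are handled throughout as Gelfand-Tsetlin patterns: \<open>G k i\<close> is the number of entries
  at most \<open>k\<close> in row \<open>i\<close> (rows counted from 0). Semistandardness is then interlacing, cutting the
  tableau at a column is truncation of the numbers \<open>G k i\<close>, the Bender-Knuth involution is a
  piecewise linear reflection of one level \<open>G k\<close>, and superposition of tableaux is addition.
\<close>

section \<open>Monomials and alternants\<close>

definition expo :: "nat \<Rightarrow> (nat \<Rightarrow> nat) \<Rightarrow> nat \<Rightarrow>\<^sub>0 nat" where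
  "expo r f = (\<Sum>i\<in>{1..r}. Poly_Mapping.single i (f i))"

definition mon :: "nat \<Rightarrow> (nat \<Rightarrow> nat) \<Rightarrow> mpoly" where
  "mon r f = Poly_Mapping.single (expo r f) 1"

lemma lookup_expo: "Poly_Mapping.lookup (expo r f) v = (if v \<in> {1..r} then f v else 0)"
proof -
  have "Poly_Mapping.lookup (expo r f) v = (\<Sum>i\<in>{1..r}. if i = v then f i else 0)"
    unfolding expo_def lookup_sum by (rule sum.cong) (auto simp: lookup_single when_def)
  also have "\<dots> = (if v \<in> {1..r} then f v else 0)"
    by (rule sum.delta) simp
  finally show ?thesis .
qed

lemma expo_eq_iff: "expo r f = expo r g \<longleftrightarrow> (\<forall>v\<in>{1..r}. f v = g v)"
proof
  assume "expo r f = expo r g"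
  then show "\<forall>v\<in>{1..r}. f v = g v" using lookup_expo[of r f] lookup_expo[of r g] by metis
qed (simp add: expo_def)

lemma mon_cong: "(\<And>v. v \<in> {1..r} \<Longrightarrow> f v = g v) \<Longrightarrow> mon r f = mon r g"
  unfolding mon_def using expo_eq_iff[of r f g] by auto

lemma mon_add: "mon r f * mon r g = mon r (\<lambda>v. f v + g v)"
proof -
  have "expo r f + expo r g = expo r (\<lambda>v. f v + g v)"
    by (rule poly_mapping_eqI) (simp add: lookup_add lookup_expo)
  then show ?thesis by (simp add: mon_def mult_single)
qed

lemma lookup_mon: "Poly_Mapping.lookup (mon r f) (expo r g) = (if \<forall>v\<in>{1..r}. f v = g v then 1 else 0)"
  by (simp add: mon_def lookup_single when_def expo_eq_iff)

lemma lookup_of_int_times: "Poly_Mapping.lookup (of_int c * p :: mpoly) m = c * Poly_Mapping.lookup p m"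
proof -
  have nat: "Poly_Mapping.lookup (of_nat n * p) m = of_nat n * Poly_Mapping.lookup p m" for n
    by (induction n) (simp_all add: lookup_add algebra_simps)
  show ?thesis
  proof (cases c)
    case (nonneg n) then show ?thesis using nat[of n] by simp
  next
    case (neg n)
    have "of_int c * p = - (of_nat (Suc n) * p)" unfolding neg by (simp del: of_nat_Suc)
    then show ?thesis using nat[of "Suc n"] neg by (simp del: of_nat_Suc)
  qed
qed

definition alt :: "nat \<Rightarrow> (nat \<Rightarrow> nat) \<Rightarrow> mpoly" where
  "alt r \<alpha> = (\<Sum>w | w permutes {1..r}. of_int (sign w) * mon r (\<alpha> \<circ> w))"

lemma alt_cong: "(\<And>v. v \<in> {1..r} \<Longrightarrow> \<alpha> v = \<beta> v) \<Longrightarrow> alt r \<alpha> = alt r \<beta>"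
  unfolding alt_def
  by (intro sum.cong refl arg_cong2[where f="(*)"] mon_cong) (auto simp: permutes_in_image simp del: atLeastAtMost_iff)

lemma alt_transpose:
  assumes "a \<in> {1..r}" "b \<in> {1..r}" "a \<noteq> b"
  shows "alt r (\<alpha> \<circ> transpose a b) = - alt r \<alpha>"
proof -
  let ?t = "transpose a b"
  have t: "?t permutes {1..r}" using assms by (intro permutes_swap_id) auto
  have perm: "permutation w" if "w permutes {1..r}" for w
    using that permutation_permutes by blast
  have "alt r (\<alpha> \<circ> ?t) = (\<Sum>w | w permutes {1..r}. of_int (sign w) * mon r (\<alpha> \<circ> (?t \<circ> w)))"
    by (simp add: alt_def o_assoc)
  also have "\<dots> = (\<Sum>w | w permutes {1..r}. - (of_int (sign w) * mon r (\<alpha> \<circ> w)))"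
  proof (rule sum.reindex_bij_witness[of _ "\<lambda>w. ?t \<circ> w" "\<lambda>w. ?t \<circ> w"])
    fix w assume "w \<in> {w. w permutes {1..r}}"
    then have w: "w permutes {1..r}" by simp
    show tt: "?t \<circ> (?t \<circ> w) = w" by (simp add: fun_eq_iff)
    show "?t \<circ> w \<in> {w. w permutes {1..r}}" using permutes_compose[OF w t] by simp
    have "sign (?t \<circ> w) = - sign w" using sign_compose[OF perm[OF t] perm[OF w]] assms by (simp add: sign_swap_id)
    then show "- (of_int (sign (?t \<circ> w)) * mon r (\<alpha> \<circ> (?t \<circ> w))) = of_int (sign w) * mon r (\<alpha> \<circ> (?t \<circ> w))"
      by simp
  qed (use permutes_compose[OF _ t] in \<open>auto simp: fun_eq_iff\<close>)
  finally show ?thesis by (simp add: alt_def sum_negf)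
qed

text \<open>On the indices \<open>1, \<dots>, r\<close> this is the staircase \<open>\<delta> = (r - 1, \<dots>, 0)\<close>, whose addition makes a weakly
  decreasing weight strictly decreasing.\<close>

definition stair :: "nat \<Rightarrow> nat \<Rightarrow> nat" where
  "stair r v = r - v"

definition dominant :: "nat \<Rightarrow> (nat \<Rightarrow> nat) \<Rightarrow> bool" where
  "dominant r \<kappa> \<longleftrightarrow> (\<forall>v. 0 < v \<and> v < r \<longrightarrow> \<kappa> (Suc v) \<le> \<kappa> v)"

abbreviation altd :: "nat \<Rightarrow> (nat \<Rightarrow> nat) \<Rightarrow> mpoly" where
  "altd r \<kappa> \<equiv> alt r (\<lambda>v. \<kappa> v + stair r v)"

lemma dominant_le:
  assumes "dominant r \<kappa>" "0 < u" "u \<le> v" "v \<le> r"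
  shows "\<kappa> v \<le> \<kappa> u"
  using assms(3,4)
proof (induction v rule: dec_induct)
  case (step n)
  have "\<kappa> (Suc n) \<le> \<kappa> n" using assms(1,2) step unfolding dominant_def by auto
  with step show ?case by simp
qed simp

lemma dominant_stair_less:
  assumes "dominant r \<kappa>" "0 < u" "u < v" "v \<le> r"
  shows "\<kappa> v + stair r v < \<kappa> u + stair r u"
  using dominant_le[of r \<kappa> u v] assms unfolding stair_def by auto

lemma increasing_permutation_is_id:
  fixes w :: "nat \<Rightarrow> nat"
  assumes w: "w permutes {1..r}"
    and mono: "\<And>u v. 0 < u \<Longrightarrow> u < v \<Longrightarrow> v \<le> r \<Longrightarrow> w u < w v"
  shows "w = id"
proof
  fix i
  show "w i = id i"
  proof (cases "i \<in> {1..r}")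
    case True
    then show ?thesis
    proof (induction i rule: less_induct)
      case (less i)
      have inj: "inj w" using w permutes_inj by auto
      obtain j where j: "j \<in> {1..r}" "w j = i"
        using permutes_image[OF w] less.prems by (metis image_iff)
      have "\<not> j < i" using less.IH[of j] j by auto
      moreover have "\<not> i < j"
      proof
        assume ij: "i < j"
        then have wi: "w i < i" using mono[of i j] j less.prems by auto
        have "w i \<in> {1..r}" using permutes_in_image[OF w] less.prems by blast
        then have "w (w i) = w i" using less.IH[OF wi] by simp
        then have "w i = i" using inj by (auto dest: injD)
        then show False using wi by simp
      qed
      ultimately show ?case using j by simp
    qed
  next
    case False
    then show ?thesis using w by (simp add: permutes_def)
  qed
qed

text \<open>Of the monomials of \<open>a(\<kappa> + \<delta>)\<close> only the one of the identity permutation has strictly decreasing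
  exponents, as a permutation that carries one strictly decreasing sequence to another is increasing.
  This yields the linear independence of the alternants, hence uniqueness of Schur expansions.\<close>

lemma lookup_altd:
  assumes l: "dominant r \<kappa>" and m: "dominant r \<mu>"
  shows "Poly_Mapping.lookup (altd r \<kappa>) (expo r (\<lambda>v. \<mu> v + stair r v)) =
    (if \<forall>v\<in>{1..r}. \<kappa> v = \<mu> v then 1 else 0)"
proof -
  let ?\<alpha> = "\<lambda>v. \<kappa> v + stair r v" and ?\<beta> = "\<lambda>v. \<mu> v + stair r v"
  have id: "w = id" if w: "w permutes {1..r}" and eq: "\<forall>v\<in>{1..r}. (?\<alpha> \<circ> w) v = ?\<beta> v" for w
  proof (rule increasing_permutation_is_id[OF w])
    fix u v :: nat assume uv: "0 < u" "u < v" "v \<le> r"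
    have "?\<beta> v < ?\<beta> u" using dominant_stair_less[OF m uv] .
    then have less: "?\<alpha> (w v) < ?\<alpha> (w u)" using eq uv by (auto simp: Ball_def)
    have in_r: "w u \<in> {1..r}" "w v \<in> {1..r}" using permutes_in_image[OF w] uv by auto
    show "w u < w v"
    proof (rule ccontr)
      assume "\<not> w u < w v"
      then consider "w v < w u" | "w u = w v" by linarith
      then show False
      proof cases
        case 1
        then have "?\<alpha> (w u) < ?\<alpha> (w v)" using dominant_stair_less[OF l, of "w v" "w u"] in_r by auto
        then show False using less by simp
      next
        case 2 then show False using less by simp
      qed
    qed
  qed
  have "Poly_Mapping.lookup (altd r \<kappa>) (expo r ?\<beta>) =
      (\<Sum>w | w permutes {1..r}. sign w * (if \<forall>v\<in>{1..r}. (?\<alpha> \<circ> w) v = ?\<beta> v then 1 else 0))"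
    by (simp add: alt_def lookup_sum lookup_of_int_times lookup_mon)
  also have "\<dots> = (\<Sum>w | w permutes {1..r}. if w = id then (if \<forall>v\<in>{1..r}. ?\<alpha> v = ?\<beta> v then 1 else 0) else 0)"
  proof (rule sum.cong[OF refl])
    fix w assume "w \<in> {w. w permutes {1..r}}"
    then show "sign w * (if \<forall>v\<in>{1..r}. (?\<alpha> \<circ> w) v = ?\<beta> v then 1 else 0) =
      (if w = id then (if \<forall>v\<in>{1..r}. ?\<alpha> v = ?\<beta> v then 1 else 0) else 0)"
      using id[of w] by (cases "w = id") auto
  qed
  also have "\<dots> = (if \<forall>v\<in>{1..r}. \<kappa> v = \<mu> v then 1 else 0)"
    by (subst sum.delta) (simp_all add: finite_permutations)
  finally show ?thesis .
qed

lemma altd_zero_nonzero: "altd r (\<lambda>_. 0) \<noteq> 0"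
proof
  assume "altd r (\<lambda>_. 0) = 0"
  then have "Poly_Mapping.lookup (altd r (\<lambda>_. 0)) (expo r (\<lambda>v. 0 + stair r v)) = 0" by simp
  then show False by (subst (asm) lookup_altd) (auto simp: dominant_def)
qed

text \<open>Each permutation \<open>w\<close> in the alternant may be moved into the symmetric factor, where it aligns the
  two exponents; this is the only use of symmetry.\<close>

lemma alt_times_mon_sum:
  assumes fin: "finite X"
    and sym: "\<And>w. w permutes {1..r} \<Longrightarrow> (\<Sum>x\<in>X. mon r (f x)) = (\<Sum>x\<in>X. mon r (f x \<circ> w))"
  shows "alt r \<alpha> * (\<Sum>x\<in>X. mon r (f x)) = (\<Sum>x\<in>X. alt r (\<lambda>v. \<alpha> v + f x v))"
proof -
  let ?P = "{w. w permutes {1..r}}"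
  have "alt r \<alpha> * (\<Sum>x\<in>X. mon r (f x)) =
      (\<Sum>w\<in>?P. of_int (sign w) * mon r (\<alpha> \<circ> w) * (\<Sum>x\<in>X. mon r (f x)))"
    by (simp add: alt_def sum_distrib_right)
  also have "\<dots> = (\<Sum>w\<in>?P. of_int (sign w) * mon r (\<alpha> \<circ> w) * (\<Sum>x\<in>X. mon r (f x \<circ> w)))"
    by (rule sum.cong[OF refl]) (use sym in auto)
  also have "\<dots> = (\<Sum>w\<in>?P. \<Sum>x\<in>X. of_int (sign w) * mon r ((\<lambda>v. \<alpha> v + f x v) \<circ> w))"
    by (simp add: sum_distrib_left mult.assoc mon_add o_def)
  also have "\<dots> = (\<Sum>x\<in>X. alt r (\<lambda>v. \<alpha> v + f x v))"
    unfolding alt_def by (rule sum.swap)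
  finally show ?thesis .
qed

lemma adjacent_invariant_transpose:
  fixes N :: "(nat \<Rightarrow> nat) \<Rightarrow> 'a"
  assumes adj: "\<And>\<beta> v. 0 < v \<Longrightarrow> v < r \<Longrightarrow> N (transpose v (Suc v) \<circ> \<beta>) = N \<beta>"
    and "0 < a" "a < b" "b \<le> r"
  shows "N (transpose a b \<circ> \<beta>) = N \<beta>"
  using Suc_leI[OF assms(3)] assms(4)
proof (induction b arbitrary: \<beta> rule: dec_induct)
  case base
  show ?case by (rule adj) (use base assms(2) in auto)
next
  case (step n)
  let ?t = "transpose n (Suc n)"
  have n: "0 < n" "n < r" using step by auto
  have "transpose a (Suc n) = ?t \<circ> transpose a n \<circ> ?t"
    using step.hyps by (auto simp: transpose_def fun_eq_iff)
  then have "transpose a (Suc n) \<circ> \<beta> = ?t \<circ> (transpose a n \<circ> (?t \<circ> \<beta>))"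
    by (simp only: o_assoc)
  then have "N (transpose a (Suc n) \<circ> \<beta>) = N (?t \<circ> (transpose a n \<circ> (?t \<circ> \<beta>)))" by simp
  also have "\<dots> = N (transpose a n \<circ> (?t \<circ> \<beta>))" by (rule adj[OF n])
  also have "\<dots> = N (?t \<circ> \<beta>)" by (rule step.IH) (use n in simp)
  also have "\<dots> = N \<beta>" by (rule adj[OF n])
  finally show ?case .
qed

text \<open>The form in which symmetry is used: the Bender-Knuth involutions supply invariance under adjacent
  transpositions only, and these generate the symmetric group.\<close>

lemma adjacent_invariant:
  fixes N :: "(nat \<Rightarrow> nat) \<Rightarrow> 'a"
  assumes adj: "\<And>\<beta> v. 0 < v \<Longrightarrow> v < r \<Longrightarrow> N (transpose v (Suc v) \<circ> \<beta>) = N \<beta>"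
    and w: "w permutes {1..r}"
  shows "N (w \<circ> \<beta>) = N \<beta>"
  using w finite_atLeastAtMost
proof (induction w rule: permutes_induct)
  case (swap a b p)
  have "N (transpose a b \<circ> \<gamma>) = N \<gamma>" for \<gamma>
  proof (cases a b rule: linorder_cases)
    case less then show ?thesis using adjacent_invariant_transpose[of r N a b, OF adj] swap(1,2) by simp
  next
    case equal then show ?thesis by simp
  next
    case greater
    then have "N (transpose b a \<circ> \<gamma>) = N \<gamma>"
      using adjacent_invariant_transpose[of r N b a, OF adj] swap(1,2) by simp
    then show ?thesis by (simp only: transpose_commute)
  qed
  from this[of "p \<circ> \<beta>"] show ?case using swap.IH by (simp only: o_assoc)
qed simp_all

section \<open>Gelfand-Tsetlin patterns and the Bender-Knuth involution\<close>

text \<open>Patterns with last level \<open>m\<close> encode semistandard tableaux with entries in \<open>1, \<dots>, r\<close> and row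
  lengths \<open>m\<close>. Making the levels constant from \<open>r\<close> on gives every pattern a single encoding.\<close>

definition gt :: "nat \<Rightarrow> (nat \<Rightarrow> nat) \<Rightarrow> (nat \<Rightarrow> nat \<Rightarrow> nat) set" where
  "gt r m = {G. G 0 = (\<lambda>_. 0) \<and> (\<forall>k\<ge>r. G k = m) \<and>
     (\<forall>k i. G k i \<le> G (Suc k) i \<and> G (Suc k) (Suc i) \<le> G k i)}"

text \<open>The number of entries at most \<open>k\<close> outside the first \<open>j\<close> columns of the tableau; \<open>head\<close> below counts
  those inside them. Only rows below \<open>r\<close> can be nonempty.\<close>

definition tail :: "nat \<Rightarrow> (nat \<Rightarrow> nat \<Rightarrow> nat) \<Rightarrow> nat \<Rightarrow> nat \<Rightarrow> nat" where
  "tail r G j k = (\<Sum>i<r. G k i - j)"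

definition head :: "nat \<Rightarrow> (nat \<Rightarrow> nat \<Rightarrow> nat) \<Rightarrow> nat \<Rightarrow> nat \<Rightarrow> nat" where
  "head r G j k = (\<Sum>i<r. min j (G k i))"

text \<open>The number of entries equal to \<open>v\<close>, which is the exponent of the variable \<open>v\<close>.\<close>

definition wt :: "nat \<Rightarrow> (nat \<Rightarrow> nat \<Rightarrow> nat) \<Rightarrow> nat \<Rightarrow> nat" where
  "wt r G v = (\<Sum>i<r. G v i) - (\<Sum>i<r. G (v - 1) i)"

lemma gt_D:
  assumes "G \<in> gt r m"
  shows "G 0 i = 0" "k \<ge> r \<Longrightarrow> G k = m" "G k i \<le> G (Suc k) i" "G (Suc k) (Suc i) \<le> G k i"
  using assms by (auto simp: gt_def)

lemma gt_mono: "G \<in> gt r m \<Longrightarrow> k \<le> k' \<Longrightarrow> G k i \<le> G k' i"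
  by (rule lift_Suc_mono_le[of "\<lambda>k. G k i"]) (auto dest: gt_D)

lemma gt_antimono_row:
  assumes "G \<in> gt r m" shows "G k (Suc i) \<le> G k i"
proof (cases k)
  case 0 then show ?thesis using gt_D[OF assms] by simp
next
  case (Suc k')
  then show ?thesis using gt_D(3,4)[OF assms, of k' i] by simp
qed

lemma gt_zero:
  assumes "G \<in> gt r m" "k \<le> i" shows "G k i = 0"
  using assms(2)
proof (induction k arbitrary: i)
  case 0 then show ?case using gt_D[OF assms(1)] by simp
next
  case (Suc k)
  then obtain i' where "i = Suc i'" "k \<le> i'" by (cases i) auto
  then show ?case using Suc.IH[of i'] gt_D(4)[OF assms(1), of k i'] by simp
qed

lemma gt_zero_r:
  assumes "G \<in> gt r m" "r \<le> i" shows "G k i = 0"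
proof (cases "k \<le> r")
  case True then show ?thesis using gt_zero[OF assms(1)] assms(2) by simp
next
  case False
  then have "G k = G r" using gt_D(2)[OF assms(1)] by simp
  then show ?thesis using gt_zero[OF assms(1,2)] by simp
qed

lemma tail_plus_head: "tail r G j k + head r G j k = (\<Sum>i<r. G k i)"
  unfolding tail_def head_def sum.distrib[symmetric] by (rule sum.cong) auto

lemma wt_add: 
  assumes "G \<in> gt r m" 
  shows "wt r G (Suc u) + tail r G j u + head r G j u = tail r G j (Suc u) + head r G j (Suc u)"
proof -
  have "(\<Sum>i<r. G u i) \<le> (\<Sum>i<r. G (Suc u) i)" by (rule sum_mono) (rule gt_D(3)[OF assms])
  then show ?thesis using tail_plus_head[of r G j] by (simp add: wt_def add.assoc)
qed

text \<open>The Bender-Knuth involution for the entries \<open>u + 1\<close> and \<open>u + 2\<close> in the first \<open>j\<close> columns. Inside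
  these columns the interlacing conditions confine \<open>G (u + 1) i\<close> to an interval, and reflecting it
  in the middle of that interval exchanges the numbers of free entries \<open>u + 1\<close> and \<open>u + 2\<close> of the
  row: those that are not stacked upon each other in one column. A row in which the entries at
  most \<open>u + 1\<close> reach beyond column \<open>j\<close> is left alone; when column \<open>j\<close> (counted from 0) has no
  entry \<open>u + 1\<close>, such a row has no entries \<open>u + 1\<close> or \<open>u + 2\<close> in the first \<open>j\<close> columns.\<close>

definition toggle :: "nat \<Rightarrow> nat \<Rightarrow> (nat \<Rightarrow> nat \<Rightarrow> nat) \<Rightarrow> nat \<Rightarrow> nat \<Rightarrow> nat" where
  "toggle u j G = G(Suc u := (\<lambda>i. if j < G (Suc u) i then G (Suc u) i
     else max (G u i) (G (Suc (Suc u)) (Suc i))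
       + min (min j (G (Suc (Suc u)) i)) (if i = 0 then j else G u (i - 1)) - G (Suc u) i))"

lemma toggle_other: "k \<noteq> Suc u \<Longrightarrow> toggle u j G k = G k"
  by (simp add: toggle_def)

lemma toggle_fixed: "j < G (Suc u) i \<Longrightarrow> toggle u j G (Suc u) i = G (Suc u) i"
  by (simp add: toggle_def)

lemma toggle_reflect:
  assumes G: "G \<in> gt r m" and j: "G (Suc u) i \<le> j"
  defines "lo \<equiv> max (G u i) (G (Suc (Suc u)) (Suc i))"
    and "hi \<equiv> min (min j (G (Suc (Suc u)) i)) (if i = 0 then j else G u (i - 1))"
  shows "lo \<le> toggle u j G (Suc u) i" "toggle u j G (Suc u) i \<le> hi"
    "toggle u j G (Suc u) i + G (Suc u) i = lo + hi"
proof -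
  have "lo \<le> G (Suc u) i" using gt_D(3,4)[OF G] by (simp add: lo_def)
  moreover have "G (Suc u) i \<le> hi"
    using gt_D(3)[OF G, of "Suc u" i] gt_D(4)[OF G, of u "i - 1"] j by (cases i) (simp_all add: hi_def)
  moreover have "toggle u j G (Suc u) i = lo + hi - G (Suc u) i"
    using j by (simp add: toggle_def lo_def hi_def)
  ultimately show "lo \<le> toggle u j G (Suc u) i" "toggle u j G (Suc u) i \<le> hi"
    "toggle u j G (Suc u) i + G (Suc u) i = lo + hi" by linarith+
qed

lemma toggle_le_iff:
  assumes "G \<in> gt r m" shows "toggle u j G (Suc u) i \<le> j \<longleftrightarrow> G (Suc u) i \<le> j"
  using toggle_fixed[of j G u i] toggle_reflect(2)[OF assms, of u i j] by fastforce

lemma toggle_gt: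
  assumes G: "G \<in> gt r m" and u: "Suc u < r"
  shows "toggle u j G \<in> gt r m"
proof -
  let ?T = "toggle u j G"
  have "?T k i \<le> ?T (Suc k) i \<and> ?T (Suc k) (Suc i) \<le> ?T k i" for k i
  proof -
    consider "k = u" | "k = Suc u" | "k \<noteq> u" "k \<noteq> Suc u" by blast
    then show ?thesis
    proof cases
      case 1
      have "G u i \<le> ?T (Suc u) i"
        using toggle_reflect(1)[OF G, of u i j] toggle_fixed[of j G u i] gt_D(3)[OF G, of u i] by fastforce
      moreover have "?T (Suc u) (Suc i) \<le> G u i"
        using toggle_reflect(2)[OF G, of u "Suc i" j] toggle_fixed[of j G u "Suc i"] gt_D(4)[OF G, of u i]
        by fastforce
      ultimately show ?thesis using 1 by (simp add: toggle_other)
    next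
      case 2
      have "?T (Suc u) i \<le> G (Suc (Suc u)) i"
        using toggle_reflect(2)[OF G, of u i j] toggle_fixed[of j G u i] gt_D(3)[OF G, of "Suc u" i] by fastforce
      moreover have "G (Suc (Suc u)) (Suc i) \<le> ?T (Suc u) i"
        using toggle_reflect(1)[OF G, of u i j] toggle_fixed[of j G u i] gt_D(4)[OF G, of "Suc u" i] by fastforce
      ultimately show ?thesis using 2 by (simp add: toggle_other)
    next
      case 3
      then show ?thesis using gt_D[OF G] by (simp add: toggle_other)
    qed
  qed
  then show ?thesis using gt_D[OF G] u unfolding gt_def by (auto simp: toggle_other)
qed

lemma toggle_toggle:
  assumes G: "G \<in> gt r m" and u: "Suc u < r"
  shows "toggle u j (toggle u j G) = G"
proof (rule ext, rule ext)
  fix k i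
  let ?T = "toggle u j G"
  show "toggle u j ?T k i = G k i"
  proof (cases "k = Suc u")
    case True
    show ?thesis
    proof (cases "j < G (Suc u) i")
      case True
      then show ?thesis using \<open>k = Suc u\<close> by (simp add: toggle_fixed)
    next
      case False
      then have "?T (Suc u) i \<le> j" using toggle_le_iff[OF G] by simp
      note twice = toggle_reflect(3)[OF toggle_gt[OF G u] this]
      have other: "?T u = G u" "?T (Suc (Suc u)) = G (Suc (Suc u))" by (simp_all add: toggle_other)
      have le: "G (Suc u) i \<le> j" using False by (simp only: not_less)
      have "toggle u j ?T (Suc u) i + ?T (Suc u) i = ?T (Suc u) i + G (Suc u) i"
        unfolding twice other toggle_reflect(3)[OF G le] ..
      then show ?thesis using \<open>k = Suc u\<close> by (simp only: add.commute[of "?T (Suc u) i"] add_right_cancel)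
    qed
  qed (simp add: toggle_other)
qed

lemma tail_toggle:
  assumes "G \<in> gt r m" "j \<le> j'"
  shows "tail r (toggle u j G) j' = tail r G j'"
proof
  fix k
  have "toggle u j G (Suc u) i - j' = G (Suc u) i - j'" for i
    using toggle_le_iff[OF assms(1), of u j i] toggle_fixed[of j G u i] assms(2) by force
  then show "tail r (toggle u j G) j' k = tail r G j' k"
    by (cases "k = Suc u") (simp_all add: tail_def toggle_other)
qed

text \<open>The lower end of the interval of one row and the upper end of that of the next row are the maximum
  and the minimum of the same two numbers, so the sum over the rows telescopes.\<close>

lemma sum_max_min_interleave:
  fixes p q :: "nat \<Rightarrow> nat"
  assumes "q 0 \<le> j"
  shows "(\<Sum>i<n. max (p i) (q (Suc i)) + min (q i) (if i = 0 then j else p (i - 1)))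
      + min (q n) (if n = 0 then j else p (n - 1)) = (\<Sum>i<n. p i) + (\<Sum>i<Suc n. q i)"
proof (induction n)
  case (Suc n)
  have "max (p n) (q (Suc n)) + min (q (Suc n)) (p n) = p n + q (Suc n)" by (simp add: max_def min_def)
  then show ?case using Suc by simp
qed (use assms in simp)

lemma head_toggle:
  assumes G: "G \<in> gt r m" and u: "Suc u < r"
    and free: "\<And>i. j < G (Suc u) i \<Longrightarrow> j < G u i"
  shows "head r (toggle u j G) j (Suc u) + head r G j (Suc u) = head r G j u + head r G j (Suc (Suc u))"
proof -
  let ?p = "\<lambda>i. min j (G u i)" and ?q = "\<lambda>i. min j (G (Suc (Suc u)) i)"
  have "min j (toggle u j G (Suc u) i) + min j (G (Suc u) i) =
      max (?p i) (?q (Suc i)) + min (?q i) (if i = 0 then j else ?p (i - 1))" for i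
  proof (cases "j < G (Suc u) i")
    case True
    then have "j < G u i" using free by blast
    moreover have "j < G (Suc (Suc u)) i" using True gt_D(3)[OF G, of "Suc u" i] by simp
    moreover have "i = 0 \<or> j < G u (i - 1)" using True gt_D(4)[OF G, of u "i - 1"] by (cases i) auto
    ultimately show ?thesis using True by (cases i) (simp_all add: toggle_fixed)
  next
    case False
    then have le: "G (Suc u) i \<le> j" "toggle u j G (Suc u) i \<le> j" using toggle_le_iff[OF G] by auto
    have "G u i \<le> j" "G (Suc (Suc u)) (Suc i) \<le> j"
      using le gt_D(3)[OF G, of u i] gt_D(4)[OF G, of "Suc u" i] by linarith+
    then have eqs: "?p i = G u i" "?q (Suc i) = G (Suc (Suc u)) (Suc i)"
      "min j (G (Suc u) i) = G (Suc u) i" "min j (toggle u j G (Suc u) i) = toggle u j G (Suc u) i"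
      using le by simp_all
    have "min (min j a) (min j b) = min (min j a) b" for a b :: nat
      by (auto simp: min_def)
    then have "min (?q i) (if i = 0 then j else ?p (i - 1)) =
        min (?q i) (if i = 0 then j else G u (i - 1))"
      by (cases "i = 0") (simp_all only: if_True if_False refl)
    then show ?thesis by (simp only: eqs toggle_reflect(3)[OF G le(1)])
  qed
  then have "head r (toggle u j G) j (Suc u) + head r G j (Suc u) =
      (\<Sum>i<r. max (?p i) (?q (Suc i)) + min (?q i) (if i = 0 then j else ?p (i - 1)))"
    by (simp add: head_def sum.distrib[symmetric])
  also have "\<dots> = (\<Sum>i<r. ?p i) + (\<Sum>i<Suc r. ?q i)"
  proof -
    have q: "?q 0 \<le> j" "?q r = 0" using gt_zero_r[OF G, of r] by simp_all
    show ?thesis using sum_max_min_interleave[of ?q j ?p r, OF q(1)] by (simp only: q(2) min_0L add_0_right)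
  qed
  also have "\<dots> = head r G j u + head r G j (Suc (Suc u))"
    using gt_zero_r[OF G] by (simp add: head_def)
  finally show ?thesis .
qed

lemma wt_toggle_other:
  assumes "v \<noteq> Suc u" "v \<noteq> Suc (Suc u)" "0 < v"
  shows "wt r (toggle u j G) v = wt r G v"
  using assms by (cases v) (simp_all add: wt_def toggle_other)

text \<open>Inside the first \<open>j\<close> columns the toggle exchanges the numbers of the two entries, outside them it
  changes nothing. The hypothesis \<open>free\<close> says that column \<open>j\<close> contains no entry \<open>u + 1\<close>. The
  equations are written without subtraction.\<close>

lemma wt_toggle:
  assumes G: "G \<in> gt r m" and u: "Suc u < r"
    and free: "\<And>i. j < G (Suc u) i \<Longrightarrow> j < G u i"
  shows "wt r (toggle u j G) (Suc u) + tail r G j u + tail r G j (Suc (Suc u)) =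
      wt r G (Suc (Suc u)) + 2 * tail r G j (Suc u)"
    and "wt r (toggle u j G) (Suc (Suc u)) + 2 * tail r G j (Suc u) =
      wt r G (Suc u) + tail r G j u + tail r G j (Suc (Suc u))"
proof -
  note T = toggle_gt[OF G u, of j]
  have "head r (toggle u j G) j k = head r G j k" if "k \<noteq> Suc u" for k
    using that by (simp add: head_def toggle_other)
  note this[of u] this[of "Suc (Suc u)"]
  then show "wt r (toggle u j G) (Suc u) + tail r G j u + tail r G j (Suc (Suc u)) =
      wt r G (Suc (Suc u)) + 2 * tail r G j (Suc u)"
    "wt r (toggle u j G) (Suc (Suc u)) + 2 * tail r G j (Suc u) =
      wt r G (Suc u) + tail r G j u + tail r G j (Suc (Suc u))"
    using head_toggle[OF G u free] wt_add[OF G, of u j] wt_add[OF G, of "Suc u" j]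
      wt_add[OF T, of u j] wt_add[OF T, of "Suc u" j]
    by (simp_all add: tail_toggle[OF G])
qed

section \<open>Schur polynomials as sums over patterns\<close>

definition row :: "nat list \<Rightarrow> nat \<Rightarrow> nat" where
  "row \<nu> i = (if i < length \<nu> then \<nu> ! i else 0)"

lemma cells_iff: "(i, j) \<in> cells \<nu> \<longleftrightarrow> j < row \<nu> i"
  by (simp add: cells_def row_def)

lemma row_Suc_le: "young_diagram \<nu> \<Longrightarrow> row \<nu> (Suc i) \<le> row \<nu> i"
  by (auto simp: young_diagram_def row_def sorted_wrt_iff_nth_less)

lemma finite_cells: "finite (cells \<nu>)"
proof -
  have "cells \<nu> = Sigma {..<length \<nu>} (\<lambda>i. {..<\<nu> ! i})" by (auto simp: cells_def)
  then show ?thesis by simp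
qed

lemma finite_ssyt: "finite (ssyt r \<nu>)"
  by (rule finite_subset[of _ "cells \<nu> \<rightarrow>\<^sub>E {1..r}"]) (auto simp: ssyt_def finite_cells intro: finite_PiE)

lemma down_closed_eq_lessThan:
  fixes S :: "nat set"
  assumes "finite S" "\<And>x. Suc x \<in> S \<Longrightarrow> x \<in> S"
  shows "S = {..<card S}"
proof -
  define n where "n = (LEAST n. n \<notin> S)"
  have n: "n \<notin> S" unfolding n_def by (rule LeastI_ex) (use assms(1) ex_new_if_finite infinite_UNIV_nat in blast)
  have "x \<in> S" if "x < n" for x using that not_less_Least unfolding n_def by blast
  moreover have "x \<notin> S" if "n \<le> x" for x
    using that by (induction x rule: dec_induct) (use n assms(2) in auto)
  ultimately have "S = {..<n}" by (auto simp: not_le[symmetric])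
  then show ?thesis by simp
qed

text \<open>Passage between tableaux and patterns. Rows increase weakly, so the entries at most \<open>k\<close> fill an
  initial segment of the row, whose length determines it.\<close>

definition tab_gt :: "nat list \<Rightarrow> (nat \<times> nat \<Rightarrow> nat) \<Rightarrow> nat \<Rightarrow> nat \<Rightarrow> nat" where
  "tab_gt \<nu> T k i = card {j. j < row \<nu> i \<and> T (i, j) \<le> k}"

definition gt_tab :: "nat list \<Rightarrow> (nat \<Rightarrow> nat \<Rightarrow> nat) \<Rightarrow> nat \<times> nat \<Rightarrow> nat" where
  "gt_tab \<nu> G b = (if b \<in> cells \<nu> then LEAST k. snd b < G k (fst b) else undefined)"

lemma ssyt_D:
  assumes "T \<in> ssyt r \<nu>"
  shows "j < row \<nu> i \<Longrightarrow> 0 < T (i, j)" "j < row \<nu> i \<Longrightarrow> T (i, j) \<le> r"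
    "Suc j < row \<nu> i \<Longrightarrow> T (i, j) \<le> T (i, Suc j)"
    "j < row \<nu> i \<Longrightarrow> j < row \<nu> (Suc i) \<Longrightarrow> T (i, j) < T (Suc i, j)"
    "b \<notin> cells \<nu> \<Longrightarrow> T b = undefined"
proof -
  have T: "T \<in> cells \<nu> \<rightarrow>\<^sub>E {1..r}" using assms by (simp add: ssyt_def)
  show "j < row \<nu> i \<Longrightarrow> 0 < T (i, j)" "j < row \<nu> i \<Longrightarrow> T (i, j) \<le> r"
    using PiE_mem[OF T, of "(i, j)"] by (auto simp: cells_iff)
  show "b \<notin> cells \<nu> \<Longrightarrow> T b = undefined" using T by (rule PiE_arb)
  show "Suc j < row \<nu> i \<Longrightarrow> T (i, j) \<le> T (i, Suc j)"
    "j < row \<nu> i \<Longrightarrow> j < row \<nu> (Suc i) \<Longrightarrow> T (i, j) < T (Suc i, j)"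
    using assms by (auto simp: ssyt_def cells_iff)
qed

lemma less_tab_gt_iff:
  assumes "T \<in> ssyt r \<nu>"
  shows "j < tab_gt \<nu> T k i \<longleftrightarrow> j < row \<nu> i \<and> T (i, j) \<le> k"
proof -
  have "{j. j < row \<nu> i \<and> T (i, j) \<le> k} = {..<tab_gt \<nu> T k i}"
    unfolding tab_gt_def
    by (rule down_closed_eq_lessThan) (auto dest: ssyt_D(3)[OF assms])
  then show ?thesis by auto
qed

lemma tab_gt_in_gt:
  assumes \<nu>: "young_diagram \<nu>" and T: "T \<in> ssyt r \<nu>"
  shows "tab_gt \<nu> T \<in> gt r (row \<nu>)"
proof -
  note iff = less_tab_gt_iff[OF T]
  have eq: "tab_gt \<nu> T k i = n" if "\<And>j. j < tab_gt \<nu> T k i \<longleftrightarrow> j < n" for k i n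
    using that by (meson linorder_neqE_nat less_irrefl)
  have le: "tab_gt \<nu> T k i \<le> n" if "\<And>j. j < tab_gt \<nu> T k i \<Longrightarrow> j < n" for k i n
    using that by (meson less_irrefl not_le)
  show ?thesis unfolding gt_def
  proof (intro CollectI conjI allI impI)
    show "tab_gt \<nu> T 0 = (\<lambda>_. 0)"
      by (rule ext, rule eq) (use ssyt_D(1)[OF T] iff in fastforce)
    show "tab_gt \<nu> T k = row \<nu>" if "r \<le> k" for k
    proof (rule ext, rule eq)
      fix i j show "j < tab_gt \<nu> T k i \<longleftrightarrow> j < row \<nu> i"
        using iff[of j k i] ssyt_D(2)[OF T, of j i] that by auto
    qed
    show "tab_gt \<nu> T k i \<le> tab_gt \<nu> T (Suc k) i" for k i
      by (rule le) (auto simp: iff)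
    show "tab_gt \<nu> T (Suc k) (Suc i) \<le> tab_gt \<nu> T k i" for k i
    proof (rule le)
      fix j assume "j < tab_gt \<nu> T (Suc k) (Suc i)"
      then have *: "j < row \<nu> (Suc i)" "T (Suc i, j) \<le> Suc k" by (auto simp: iff)
      then have "j < row \<nu> i" using row_Suc_le[OF \<nu>, of i] by simp
      then show "j < tab_gt \<nu> T k i" using * ssyt_D(4)[OF T, of j i] by (auto simp: iff)
    qed
  qed
qed

lemma gt_tab_le_iff:
  assumes G: "G \<in> gt r (row \<nu>)" and j: "j < row \<nu> i"
  shows "gt_tab \<nu> G (i, j) \<le> k \<longleftrightarrow> j < G k i"
proof -
  have eq: "gt_tab \<nu> G (i, j) = (LEAST k. j < G k i)" using j by (simp add: gt_tab_def cells_iff)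
  have "j < G r i" using gt_D(2)[OF G, of r] j by simp
  then have *: "j < G (gt_tab \<nu> G (i, j)) i" unfolding eq by (rule LeastI)
  show ?thesis
  proof
    assume "gt_tab \<nu> G (i, j) \<le> k"
    then show "j < G k i" using * gt_mono[OF G, of "gt_tab \<nu> G (i, j)" k i] by simp
  next
    assume "j < G k i" then show "gt_tab \<nu> G (i, j) \<le> k" unfolding eq by (rule Least_le)
  qed
qed

lemma gt_tab_in_ssyt:
  assumes G: "G \<in> gt r (row \<nu>)"
  shows "gt_tab \<nu> G \<in> ssyt r \<nu>"
proof -
  note iff = gt_tab_le_iff[OF G]
  have pos: "gt_tab \<nu> G (i, j) \<noteq> 0" if "j < row \<nu> i" for i j
    using iff[OF that, of 0] gt_D(1)[OF G] by simp
  have "gt_tab \<nu> G \<in> cells \<nu> \<rightarrow>\<^sub>E {1..r}"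
  proof (rule PiE_I)
    fix b assume b: "b \<in> cells \<nu>"
    obtain i j where ij: "b = (i, j)" by fastforce
    then have "j < row \<nu> i" using b by (simp add: cells_iff)
    then show "gt_tab \<nu> G b \<in> {1..r}" using pos[of j i] iff[of j i r] gt_D(2)[OF G, of r] ij by simp
  qed (simp add: gt_tab_def)
  moreover have "gt_tab \<nu> G (i, j) \<le> gt_tab \<nu> G (i, Suc j)" if "Suc j < row \<nu> i" for i j
    using iff[of "Suc j" i "gt_tab \<nu> G (i, Suc j)"] that by (subst iff) auto
  moreover have "gt_tab \<nu> G (i, j) < gt_tab \<nu> G (Suc i, j)" if ij: "j < row \<nu> i" "j < row \<nu> (Suc i)" for i j
  proof -
    obtain k where k: "gt_tab \<nu> G (Suc i, j) = Suc k" using not0_implies_Suc[OF pos[OF ij(2)]] by blast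
    then have "j < G (Suc k) (Suc i)" using iff[of j "Suc i" "Suc k"] ij by simp
    then have "j < G k i" using gt_D(4)[OF G, of k i] by simp
    then show ?thesis using iff[of j i k] ij k by simp
  qed
  ultimately show ?thesis by (simp add: ssyt_def cells_iff)
qed

lemma gt_tab_tab_gt:
  assumes T: "T \<in> ssyt r \<nu>" shows "gt_tab \<nu> (tab_gt \<nu> T) = T"
proof
  fix b :: "nat \<times> nat" obtain i j where ij: "b = (i, j)" by fastforce
  show "gt_tab \<nu> (tab_gt \<nu> T) b = T b"
  proof (cases "j < row \<nu> i")
    case True
    then have "gt_tab \<nu> (tab_gt \<nu> T) b = (LEAST k. T (i, j) \<le> k)"
      by (simp add: gt_tab_def ij cells_iff less_tab_gt_iff[OF T])
    also have "\<dots> = T (i, j)" by (rule Least_equality) auto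
    finally show ?thesis using ij by simp
  next
    case False
    then show ?thesis using ssyt_D(5)[OF T, of b] by (simp add: ij gt_tab_def cells_iff)
  qed
qed

lemma tab_gt_gt_tab:
  assumes G: "G \<in> gt r (row \<nu>)" shows "tab_gt \<nu> (gt_tab \<nu> G) = G"
proof (rule ext, rule ext)
  fix k i
  have "G k i \<le> row \<nu> i" using gt_mono[OF G, of k "max k r" i] gt_D(2)[OF G, of "max k r"] by simp
  then have "{j. j < row \<nu> i \<and> gt_tab \<nu> G (i, j) \<le> k} = {..<G k i}"
    using gt_tab_le_iff[OF G] by auto
  then show "tab_gt \<nu> (gt_tab \<nu> G) k i = G k i" by (simp add: tab_gt_def)
qed

lemma bij_betw_tab_gt:
  assumes "young_diagram \<nu>" shows "bij_betw (tab_gt \<nu>) (ssyt r \<nu>) (gt r (row \<nu>))"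
  by (rule bij_betw_byWitness[of _ "gt_tab \<nu>"])
     (use assms gt_tab_tab_gt tab_gt_gt_tab tab_gt_in_gt gt_tab_in_ssyt in blast)+

lemma finite_gt: "young_diagram \<nu> \<Longrightarrow> finite (gt r (row \<nu>))"
  using bij_betw_finite[OF bij_betw_tab_gt] finite_ssyt by blast

lemma tableau_monomial:
  assumes T: "T \<in> ssyt r \<nu>" and len: "length \<nu> \<le> r"
  shows "(\<Prod>b\<in>cells \<nu>. var (T b)) = mon r (wt r (tab_gt \<nu> T))"
proof -
  have "(\<Prod>b\<in>B. var (T b)) = Poly_Mapping.single (\<Sum>b\<in>B. Poly_Mapping.single (T b) 1) 1"
    if "finite B" for B
    using that by induction (simp_all add: var_def mult_single)
  note prod = this[OF finite_cells[of \<nu>]]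
  have rows: "(\<Sum>i<r. tab_gt \<nu> T k i) = card {b \<in> cells \<nu>. T b \<le> k}" for k
  proof -
    have "{b \<in> cells \<nu>. T b \<le> k} = Sigma {..<r} (\<lambda>i. {j. j < row \<nu> i \<and> T (i, j) \<le> k})"
      using len by (auto simp: cells_def row_def split: if_splits)
    then show ?thesis by (simp add: tab_gt_def)
  qed
  have in_r: "T b \<in> {1..r}" if "b \<in> cells \<nu>" for b
    using that T by (auto simp: ssyt_def)
  have "(\<Sum>b\<in>cells \<nu>. Poly_Mapping.single (T b) 1) = expo r (wt r (tab_gt \<nu> T))"
  proof (rule poly_mapping_eqI)
    fix v
    have "Poly_Mapping.lookup (\<Sum>b\<in>cells \<nu>. Poly_Mapping.single (T b) 1) v = (\<Sum>b\<in>cells \<nu>. if T b = v then 1 else (0::nat))"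
      unfolding lookup_sum by (rule sum.cong) (auto simp: lookup_single when_def)
    also have "\<dots> = card {b \<in> cells \<nu>. T b = v}"
      using finite_cells by (simp add: sum.If_cases Int_def)
    also have "\<dots> = (if v \<in> {1..r} then wt r (tab_gt \<nu> T) v else 0)"
    proof (cases "v \<in> {1..r}")
      case True
      have "{b \<in> cells \<nu>. T b \<le> v} = {b \<in> cells \<nu>. T b \<le> v - 1} \<union> {b \<in> cells \<nu>. T b = v}"
        using True by auto
      moreover have "{b \<in> cells \<nu>. T b \<le> v - 1} \<inter> {b \<in> cells \<nu>. T b = v} = {}"
        using True by auto
      moreover have "finite {b \<in> cells \<nu>. T b \<le> v - 1}" "finite {b \<in> cells \<nu>. T b = v}"
        by (rule finite_subset[OF _ finite_cells[of \<nu>]], blast)+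
      ultimately have "card {b \<in> cells \<nu>. T b \<le> v} = card {b \<in> cells \<nu>. T b \<le> v - 1} + card {b \<in> cells \<nu>. T b = v}"
        by (simp only: card_Un_disjoint)
      then show ?thesis using True by (simp add: wt_def rows)
    next
      case False
      then have "{b \<in> cells \<nu>. T b = v} = {}" using in_r by auto
      then show ?thesis using False by (simp only: card.empty if_False)
    qed
    finally show "Poly_Mapping.lookup (\<Sum>b\<in>cells \<nu>. Poly_Mapping.single (T b) 1) v = Poly_Mapping.lookup (expo r (wt r (tab_gt \<nu> T))) v"
      by (simp only: lookup_expo)
  qed
  then show ?thesis by (simp only: prod mon_def)
qed

lemma schur_eq_sum_gt:
  assumes "young_diagram \<nu>" "length \<nu> \<le> r"
  shows "schur r \<nu> = (\<Sum>G\<in>gt r (row \<nu>). mon r (wt r G))"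
proof -
  have "schur r \<nu> = (\<Sum>T\<in>ssyt r \<nu>. mon r (wt r (tab_gt \<nu> T)))"
    unfolding schur_def by (rule sum.cong[OF refl]) (rule tableau_monomial[OF _ assms(2)])
  also have "\<dots> = (\<Sum>G\<in>gt r (row \<nu>). mon r (wt r G))"
    by (rule sum.reindex_bij_betw[OF bij_betw_tab_gt[OF assms(1)]])
  finally show ?thesis .
qed

lemma gt_le_last: "G \<in> gt r m \<Longrightarrow> G k i \<le> m 0"
proof -
  assume G: "G \<in> gt r m"
  have "G k i \<le> G (max k r) i" by (rule gt_mono[OF G]) simp
  also have "\<dots> = m i" using gt_D(2)[OF G] by simp
  also have "G r i \<le> G r 0" by (rule lift_Suc_antimono_le[of "G r"]) (use gt_antimono_row[OF G] in auto)
  then have "m i \<le> m 0" using gt_D(2)[OF G, of r] by simp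
  finally show ?thesis .
qed

text \<open>The classical symmetry of Schur polynomials: a cut behind all \<open>m 0\<close> columns lets the involution act
  on the whole tableau, with no condition left to check.\<close>

lemma sum_gt_adjacent:
  fixes f :: "(nat \<Rightarrow> nat) \<Rightarrow> 'a::comm_monoid_add"
  assumes u: "Suc u < r"
  shows "(\<Sum>G\<in>gt r m. f (wt r G \<circ> transpose (Suc u) (Suc (Suc u)))) = (\<Sum>G\<in>gt r m. f (wt r G))"
proof (rule sum.reindex_bij_witness[of _ "toggle u (m 0)" "toggle u (m 0)"])
  fix G assume G: "G \<in> gt r m"
  show "toggle u (m 0) (toggle u (m 0) G) = G" by (rule toggle_toggle[OF G u])
  then show "toggle u (m 0) (toggle u (m 0) G) = G" .
  show "toggle u (m 0) G \<in> gt r m" by (rule toggle_gt[OF G u])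
  then show "toggle u (m 0) G \<in> gt r m" .
  have tail: "tail r G (m 0) k = 0" for k by (simp add: tail_def gt_le_last[OF G])
  have free: "m 0 < G (Suc u) i \<Longrightarrow> m 0 < G u i" for i using gt_le_last[OF G, of "Suc u" i] by simp
  have "wt r (toggle u (m 0) G) v = (wt r G \<circ> transpose (Suc u) (Suc (Suc u))) v" for v
  proof -
    consider "v = 0" | "v = Suc u" | "v = Suc (Suc u)" | "v \<noteq> Suc u" "v \<noteq> Suc (Suc u)" "0 < v" by blast
    then show ?thesis
    proof cases
      case 1 then show ?thesis by (simp add: wt_def)
    next
      case 2 then show ?thesis using wt_toggle(1)[OF G u free] by (simp add: tail)
    next
      case 3 then show ?thesis using wt_toggle(2)[OF G u free] by (simp add: tail)
    next
      case 4 then show ?thesis using wt_toggle_other[of v u r "m 0" G] by simp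
    qed
  qed
  then have "wt r (toggle u (m 0) G) = wt r G \<circ> transpose (Suc u) (Suc (Suc u))" by (rule ext)
  then show "f (wt r (toggle u (m 0) G)) = f (wt r G \<circ> transpose (Suc u) (Suc (Suc u)))"
    by simp
qed

lemma sum_gt_symmetric:
  fixes f :: "(nat \<Rightarrow> nat) \<Rightarrow> 'a::comm_monoid_add"
  assumes w: "w permutes {1..r}"
  shows "(\<Sum>G\<in>gt r m. f (wt r G \<circ> w)) = (\<Sum>G\<in>gt r m. f (wt r G))"
proof -
  have "(\<Sum>G\<in>gt r m. f (wt r G \<circ> (transpose v (Suc v) \<circ> \<beta>))) = (\<Sum>G\<in>gt r m. f (wt r G \<circ> \<beta>))"
    if "0 < v" "v < r" for v \<beta>
    using sum_gt_adjacent[of "v - 1" r "\<lambda>x. f (x \<circ> \<beta>)" m] that by (simp add: o_assoc)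
  from adjacent_invariant[of r "\<lambda>\<beta>. \<Sum>G\<in>gt r m. f (wt r G \<circ> \<beta>)", OF this w, of id]
  show ?thesis by simp
qed

lemma alt_times_schur:
  assumes "young_diagram \<nu>" "length \<nu> \<le> r"
  shows "alt r \<alpha> * schur r \<nu> = (\<Sum>G\<in>gt r (row \<nu>). alt r (\<lambda>v. \<alpha> v + wt r G v))"
  unfolding schur_eq_sum_gt[OF assms]
  by (rule alt_times_mon_sum[OF finite_gt[OF assms(1)] sum_gt_symmetric[where f = "mon r", symmetric]])

section \<open>Stembridge's cancellation\<close>

text \<open>The weight \<open>\<kappa>\<close> plus the content of the columns from \<open>j\<close> on increases from index \<open>u + 1\<close> to
  index \<open>u + 2\<close>. Contents are differences of tails; moving them across the inequality avoids
  truncated subtraction.\<close>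

definition viol :: "nat \<Rightarrow> (nat \<Rightarrow> nat) \<Rightarrow> (nat \<Rightarrow> nat \<Rightarrow> nat) \<Rightarrow> nat \<Rightarrow> nat \<Rightarrow> bool" where
  "viol r \<kappa> G j u \<longleftrightarrow> Suc u < r \<and>
     \<kappa> (Suc u) + 2 * tail r G j (Suc u) < \<kappa> (Suc (Suc u)) + tail r G j (Suc (Suc u)) + tail r G j u"

definition good :: "nat \<Rightarrow> (nat \<Rightarrow> nat) \<Rightarrow> (nat \<Rightarrow> nat \<Rightarrow> nat) \<Rightarrow> bool" where
  "good r \<kappa> G \<longleftrightarrow> (\<nexists>j u. viol r \<kappa> G j u)"

text \<open>The number of entries at most \<open>k\<close> in column \<open>j\<close>.\<close>

definition height :: "nat \<Rightarrow> (nat \<Rightarrow> nat \<Rightarrow> nat) \<Rightarrow> nat \<Rightarrow> nat \<Rightarrow> nat" where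
  "height r G j k = card {i. i < r \<and> j < G k i}"

lemma tail_Suc: "tail r G j k = tail r G (Suc j) k + height r G j k"
proof -
  have "height r G j k = (\<Sum>i<r. if j < G k i then 1 else 0)"
    by (simp add: height_def sum.If_cases Int_def)
  then show ?thesis
    unfolding tail_def by (simp add: sum.distrib[symmetric]) (rule sum.cong, auto)
qed

lemma height_bounds:
  assumes "G \<in> gt r m"
  shows "height r G j u \<le> height r G j (Suc u)" "height r G j (Suc u) \<le> Suc (height r G j u)"
proof -
  show "height r G j u \<le> height r G j (Suc u)" unfolding height_def
    by (rule card_mono) (use gt_D(3)[OF assms, of u] in \<open>auto intro: less_le_trans\<close>)
  have "{i. i < r \<and> j < G (Suc u) i} \<subseteq> insert 0 (Suc ` {i. i < r \<and> j < G u i})"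
  proof
    fix i assume i: "i \<in> {i. i < r \<and> j < G (Suc u) i}"
    show "i \<in> insert 0 (Suc ` {i. i < r \<and> j < G u i})"
      using i gt_D(4)[OF assms, of u "i - 1"] by (cases i) auto
  qed
  then have "height r G j (Suc u) \<le> card (insert 0 (Suc ` {i. i < r \<and> j < G u i}))"
    unfolding height_def by (intro card_mono) auto
  also have "\<dots> = Suc (height r G j u)" by (simp add: height_def card_image card_insert_if image_iff)
  finally show "height r G j (Suc u) \<le> Suc (height r G j u)" .
qed

text \<open>Columns are strict, so each of the two entries occurs at most once in column \<open>j\<close>. If the violation
  starts in this column, the column contains \<open>u + 2\<close> but not \<open>u + 1\<close>, and the excess is exactly one.
  The first fact makes two entries of \<open>\<kappa> + content + \<delta>\<close> equal, the second is what the toggle at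
  \<open>j\<close> needs.\<close>

lemma viol_column:
  assumes G: "G \<in> gt r m" and viol: "viol r \<kappa> G j u" and later: "\<not> viol r \<kappa> G (Suc j) u"
  shows "\<kappa> (Suc (Suc u)) + tail r G j (Suc (Suc u)) + tail r G j u = Suc (\<kappa> (Suc u) + 2 * tail r G j (Suc u))"
    and "j < G (Suc u) i \<Longrightarrow> j < G u i"
proof -
  note * = viol[unfolded viol_def] later[unfolded viol_def] tail_Suc[of r G j "Suc (Suc u)"]
    tail_Suc[of r G j "Suc u"] tail_Suc[of r G j u] height_bounds[OF G, of j u] height_bounds[OF G, of j "Suc u"]
  show "\<kappa> (Suc (Suc u)) + tail r G j (Suc (Suc u)) + tail r G j u = Suc (\<kappa> (Suc u) + 2 * tail r G j (Suc u))"
    using * by linarith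
  have "height r G j u = height r G j (Suc u)" using * by linarith
  then have "{i. i < r \<and> j < G u i} = {i. i < r \<and> j < G (Suc u) i}"
    unfolding height_def
    by (intro card_subset_eq) (use gt_D(3)[OF G, of u] in \<open>auto intro: less_le_trans\<close>)
  moreover have "i < r" if "j < G (Suc u) i" using gt_zero_r[OF G, of i "Suc u"] that by (cases "i < r") auto
  ultimately show "j < G (Suc u) i \<Longrightarrow> j < G u i" by blast
qed

lemma viol_bound:
  assumes G: "G \<in> gt r m" and \<kappa>: "dominant r \<kappa>" and viol: "viol r \<kappa> G j u"
  shows "j \<le> m 0"
proof (rule ccontr)
  assume "\<not> j \<le> m 0"
  then have "G k i - j = 0" for k i using gt_le_last[OF G, of k i] by simp
  then have "tail r G j k = 0" for k by (simp add: tail_def)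
  then show False using viol \<kappa> by (fastforce simp: viol_def dominant_def)
qed

text \<open>The columns to the right of and including the last violating one are untouched by the toggle, so
  choosing the last violating column and then the least violating entry makes the choice the
  same for a pattern and its flip. This turns \<open>flip\<close> into an involution.\<close>

definition viol_col :: "nat \<Rightarrow> (nat \<Rightarrow> nat) \<Rightarrow> (nat \<Rightarrow> nat \<Rightarrow> nat) \<Rightarrow> nat" where
  "viol_col r \<kappa> G = (GREATEST j. \<exists>u. viol r \<kappa> G j u)"

definition viol_entry :: "nat \<Rightarrow> (nat \<Rightarrow> nat) \<Rightarrow> (nat \<Rightarrow> nat \<Rightarrow> nat) \<Rightarrow> nat" where
  "viol_entry r \<kappa> G = (LEAST u. viol r \<kappa> G (viol_col r \<kappa> G) u)"

definition flip :: "nat \<Rightarrow> (nat \<Rightarrow> nat) \<Rightarrow> (nat \<Rightarrow> nat \<Rightarrow> nat) \<Rightarrow> nat \<Rightarrow> nat \<Rightarrow> nat" where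
  "flip r \<kappa> G = toggle (viol_entry r \<kappa> G) (viol_col r \<kappa> G) G"

lemma
  assumes G: "G \<in> gt r m" and \<kappa>: "dominant r \<kappa>" and bad: "\<not> good r \<kappa> G"
  shows viol_chosen: "viol r \<kappa> G (viol_col r \<kappa> G) (viol_entry r \<kappa> G)"
    and no_later_viol: "viol_col r \<kappa> G < j \<Longrightarrow> \<not> viol r \<kappa> G j u"
proof -
  obtain j0 where j0: "\<exists>u. viol r \<kappa> G j0 u" using bad by (auto simp: good_def)
  have bound: "\<forall>j. (\<exists>u. viol r \<kappa> G j u) \<longrightarrow> j \<le> m 0" using viol_bound[OF G \<kappa>] by blast
  have "\<exists>u. viol r \<kappa> G (viol_col r \<kappa> G) u"
    unfolding viol_col_def by (rule GreatestI_nat[where P="\<lambda>j. \<exists>u. viol r \<kappa> G j u", OF j0]) (use bound in blast)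
  then show "viol r \<kappa> G (viol_col r \<kappa> G) (viol_entry r \<kappa> G)"
    unfolding viol_entry_def by (rule LeastI_ex)
  have "j \<le> viol_col r \<kappa> G" if "viol r \<kappa> G j u" for j u
    unfolding viol_col_def by (rule Greatest_le_nat[where b="m 0"]) (use that bound in blast)+
  then show "viol_col r \<kappa> G < j \<Longrightarrow> \<not> viol r \<kappa> G j u" by (meson not_le)
qed

lemma entry_less:
  assumes G: "G \<in> gt r m" and \<kappa>: "dominant r \<kappa>" and bad: "\<not> good r \<kappa> G"
  shows "Suc (viol_entry r \<kappa> G) < r"
  using viol_chosen[OF G \<kappa> bad] by (simp add: viol_def)

lemma flip_gt:
  assumes G: "G \<in> gt r m" and \<kappa>: "dominant r \<kappa>" and bad: "\<not> good r \<kappa> G"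
  shows "flip r \<kappa> G \<in> gt r m"
  unfolding flip_def by (rule toggle_gt[OF G entry_less[OF G \<kappa> bad]])

lemma viol_flip:
  assumes "G \<in> gt r m"
  shows "viol_col r \<kappa> G \<le> j \<Longrightarrow> viol r \<kappa> (flip r \<kappa> G) j u \<longleftrightarrow> viol r \<kappa> G j u"
  by (simp add: viol_def flip_def tail_toggle[OF assms])

lemma flip_bad:
  assumes G: "G \<in> gt r m" and \<kappa>: "dominant r \<kappa>" and bad: "\<not> good r \<kappa> G"
  shows "\<not> good r \<kappa> (flip r \<kappa> G)"
  using viol_chosen[OF G \<kappa> bad] viol_flip[OF G] unfolding good_def by blast

lemma viol_col_flip:
  assumes G: "G \<in> gt r m" and \<kappa>: "dominant r \<kappa>" and bad: "\<not> good r \<kappa> G"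
  shows "viol_col r \<kappa> (flip r \<kappa> G) = viol_col r \<kappa> G"
  unfolding viol_col_def[of r \<kappa> "flip r \<kappa> G"]
  by (rule Greatest_equality) (use viol_chosen[OF G \<kappa> bad] viol_flip[OF G] no_later_viol[OF G \<kappa> bad] in \<open>meson order_refl not_le less_imp_le\<close>)+

lemma flip_flip:
  assumes G: "G \<in> gt r m" and \<kappa>: "dominant r \<kappa>" and bad: "\<not> good r \<kappa> G"
  shows "flip r \<kappa> (flip r \<kappa> G) = G"
proof -
  have "viol_entry r \<kappa> (flip r \<kappa> G) = viol_entry r \<kappa> G"
    by (simp add: viol_entry_def viol_col_flip[OF G \<kappa> bad] viol_flip[OF G])
  then show ?thesis
    by (simp add: flip_def[of r \<kappa> "flip r \<kappa> G"] viol_col_flip[OF G \<kappa> bad]) (simp add: flip_def toggle_toggle[OF G entry_less[OF G \<kappa> bad]])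
qed

lemma altd_flip:
  assumes G: "G \<in> gt r m" and \<kappa>: "dominant r \<kappa>" and bad: "\<not> good r \<kappa> G"
  shows "altd r (\<lambda>v. \<kappa> v + wt r (flip r \<kappa> G) v) = - altd r (\<lambda>v. \<kappa> v + wt r G v)"
proof -
  define u where "u = viol_entry r \<kappa> G"
  define j where "j = viol_col r \<kappa> G"
  have viol: "viol r \<kappa> G j u" "\<not> viol r \<kappa> G (Suc j) u"
    using viol_chosen[OF G \<kappa> bad] no_later_viol[OF G \<kappa> bad, of "Suc j" u] by (simp_all add: u_def j_def)
  have u: "Suc u < r" using entry_less[OF G \<kappa> bad] by (simp add: u_def)
  note T = wt_toggle[OF G u viol_column(2)[OF G viol]]
  let ?f = "\<lambda>v. \<kappa> v + wt r G v + stair r v"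
  have "altd r (\<lambda>v. \<kappa> v + wt r (flip r \<kappa> G) v) = alt r (?f \<circ> transpose (Suc u) (Suc (Suc u)))"
  proof (rule alt_cong)
    fix v assume "v \<in> {1..r}"
    then consider "v = Suc u" | "v = Suc (Suc u)" | "v \<noteq> Suc u" "v \<noteq> Suc (Suc u)" "0 < v" by fastforce
    then show "\<kappa> v + wt r (flip r \<kappa> G) v + stair r v = (?f \<circ> transpose (Suc u) (Suc (Suc u))) v"
    proof cases
      case 3
      then show ?thesis using wt_toggle_other[of v u r j G] by (simp add: flip_def u_def j_def)
    qed (use T viol_column(1)[OF G viol] u in \<open>simp_all add: flip_def stair_def u_def[symmetric] j_def[symmetric]\<close>)
  qed
  also have "\<dots> = - alt r ?f" by (rule alt_transpose) (use u in auto)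
  finally show ?thesis .
qed

lemma bad_sum_zero:
  assumes "dominant r \<kappa>"
  shows "(\<Sum>G | G \<in> gt r m \<and> \<not> good r \<kappa> G. altd r (\<lambda>v. \<kappa> v + wt r G v)) = 0"
proof -
  let ?S = "\<Sum>G | G \<in> gt r m \<and> \<not> good r \<kappa> G. altd r (\<lambda>v. \<kappa> v + wt r G v)"
  have "?S = (\<Sum>G | G \<in> gt r m \<and> \<not> good r \<kappa> G. - altd r (\<lambda>v. \<kappa> v + wt r G v))"
    by (rule sum.reindex_bij_witness[of _ "flip r \<kappa>" "flip r \<kappa>"])
       (use assms flip_flip flip_gt flip_bad altd_flip in auto)
  then have "?S = - ?S" by (simp only: sum_negf)
  then have "?S + ?S = 0" by (simp only: eq_neg_iff_add_eq_0)
  then have "2 * ?S = 0" by (simp only: mult_2)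
  then show ?thesis by simp
qed

text \<open>The bad patterns cancel, as \<open>flip\<close> pairs terms of opposite sign.\<close>

lemma altd_times_schur:
  assumes "dominant r \<kappa>" "young_diagram \<nu>" "length \<nu> \<le> r"
  shows "altd r \<kappa> * schur r \<nu> = (\<Sum>G | G \<in> gt r (row \<nu>) \<and> good r \<kappa> G. altd r (\<lambda>v. \<kappa> v + wt r G v))"
proof -
  have "altd r \<kappa> * schur r \<nu> = (\<Sum>G\<in>gt r (row \<nu>). altd r (\<lambda>v. \<kappa> v + wt r G v))"
    unfolding alt_times_schur[OF assms(2,3)] by (simp add: ac_simps)
  also have "\<dots> = (\<Sum>G | G \<in> gt r (row \<nu>) \<and> good r \<kappa> G. altd r (\<lambda>v. \<kappa> v + wt r G v)) +
      (\<Sum>G | G \<in> gt r (row \<nu>) \<and> \<not> good r \<kappa> G. altd r (\<lambda>v. \<kappa> v + wt r G v))"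
    using finite_gt[OF assms(2), of r] by (subst sum.union_disjoint[symmetric]) (auto intro: sum.cong)
  finally show ?thesis using bad_sum_zero[OF assms(1)] by simp
qed

text \<open>Goodness at column 0 concerns the whole tableau.\<close>

lemma good_dominant:
  assumes G: "G \<in> gt r m" and "good r \<kappa> G"
  shows "dominant r (\<lambda>v. \<kappa> v + wt r G v)"
  unfolding dominant_def
proof (intro allI impI)
  fix v assume "0 < v \<and> v < r"
  then obtain u where u: "v = Suc u" "Suc u < r" by (cases v) auto
  then have "\<not> viol r \<kappa> G 0 u" using assms(2) by (simp add: good_def)
  moreover have "wt r G (Suc u) + tail r G 0 u = tail r G 0 (Suc u)" for u
    using wt_add[OF G, of u 0] by (simp add: head_def)
  note this[of u] this[of "Suc u"]
  ultimately show "\<kappa> (Suc v) + wt r G (Suc v) \<le> \<kappa> v + wt r G v"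
    using u by (simp add: viol_def)
qed

text \<open>The tableau in which row \<open>i\<close> (counted from 0) is filled with \<open>i + 1\<close>.\<close>

definition top_gt :: "(nat \<Rightarrow> nat) \<Rightarrow> nat \<Rightarrow> nat \<Rightarrow> nat" where
  "top_gt m k i = (if i < k then m i else 0)"

text \<open>Row \<open>i\<close> cannot contain an entry above \<open>i + 1\<close>. Otherwise cut at its last column: the last entry
  \<open>v + 1\<close> of row \<open>i\<close> occurs once in the part that remains, whereas \<open>v\<close> does not occur there, since
  earlier rows only have entries at most \<open>i\<close>, and the cells below that last entry exceed \<open>v + 1\<close>.\<close>

lemma good_zero_row:
  assumes G: "G \<in> gt r m" and good: "good r (\<lambda>_. 0) G" and "i < r"
  shows "G (Suc i) i = m i"
  using \<open>i < r\<close>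
proof (induction i rule: less_induct)
  case (less i)
  have const: "G k i' = m i'" if "i' < i" "i' < k" for k i'
    using less.IH[of i'] that less.prems gt_mono[OF G, of "Suc i'" k i'] gt_mono[OF G, of k "max k r" i']
      gt_D(2)[OF G, of "max k r"] by fastforce
  show ?case
  proof (rule ccontr)
    assume neq: "G (Suc i) i \<noteq> m i"
    have le: "G k i \<le> m i" for k
      using gt_mono[OF G, of k "max k r" i] gt_D(2)[OF G, of "max k r"] by simp
    define v where "v = (GREATEST v. G v i \<noteq> m i)"
    have "v \<le> r" if "G v i \<noteq> m i" for v
      using that gt_D(2)[OF G, of v] by (cases "v \<le> r") auto
    then have bound: "\<forall>v. G v i \<noteq> m i \<longrightarrow> v \<le> r" by blast
    have v: "G v i \<noteq> m i" 
      unfolding v_def by (rule GreatestI_nat[where P="\<lambda>v. G v i \<noteq> m i" and k="Suc i" and b=r]) (use neq bound in blast)+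
    have "Suc i \<le> v" 
      unfolding v_def by (rule Greatest_le_nat[where P="\<lambda>v. G v i \<noteq> m i" and b=r]) (use neq bound in blast)+
    then obtain u where u: "v = Suc u" "i \<le> u" by (cases v) auto
    have "v < r" using v gt_D(2)[OF G, of v] by (cases "v < r") auto
    have Sv: "G (Suc v) i = m i"
    proof (rule ccontr)
      assume "G (Suc v) i \<noteq> m i"
      then have "Suc v \<le> v"
        unfolding v_def by (rule Greatest_le_nat[where P="\<lambda>v. G v i \<noteq> m i" and b=r]) (use bound in blast)
      then show False by simp
    qed
    have less_m: "G v i < m i" using le v by (simp add: le_neq_implies_less)
    define j where "j = m i - 1"
    have small: "G v i \<le> j" "G u i \<le> j" using less_m gt_D(3)[OF G, of u i] u by (auto simp: j_def)
    have below: "G k i' \<le> j" if "i < i'" "k \<le> Suc v" for k i'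
    proof -
      have "G k i' \<le> G (Suc v) i'" using gt_mono[OF G that(2)] .
      also have "\<dots> \<le> G (Suc v) (Suc i)"
        by (rule lift_Suc_antimono_le[of "G (Suc v)"]) (use gt_antimono_row[OF G] that in auto)
      also have "\<dots> \<le> G v i" by (rule gt_D(4)[OF G])
      finally show ?thesis using small by simp
    qed
    define A where "A = (\<Sum>i'<i. m i' - j)"
    have tail: "tail r G j k = A + (G k i - j)" if "i \<le> k" "k \<le> Suc v" for k
    proof -
      have "tail r G j k = (\<Sum>i'\<in>{..<r}. if i' < i then m i' - j else if i' = i then G k i - j else 0)"
        unfolding tail_def by (rule sum.cong) (use const that below in \<open>auto simp: not_less_iff_gr_or_eq\<close>)
      also have "\<dots> = (\<Sum>i'\<in>{..<Suc i}. if i' < i then m i' - j else if i' = i then G k i - j else 0)"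
        by (rule sum.mono_neutral_right) (use less.prems in auto)
      also have "\<dots> = A + (G k i - j)" by (simp add: A_def)
      finally show ?thesis .
    qed
    have "viol r (\<lambda>_. 0) G j u"
      using tail[of u] tail[of "Suc u"] tail[of "Suc (Suc u)"] u \<open>v < r\<close> small Sv less_m
      by (simp add: viol_def j_def)
    then show False using good by (simp add: good_def)
  qed
qed

lemma top_gt_good:
  assumes \<nu>: "young_diagram \<nu>" "length \<nu> \<le> r"
  shows "top_gt (row \<nu>) \<in> gt r (row \<nu>)" "good r (\<lambda>_. 0) (top_gt (row \<nu>))"
    "v \<in> {1..r} \<Longrightarrow> wt r (top_gt (row \<nu>)) v = row \<nu> (v - 1)"
proof -
  have zero: "row \<nu> i = 0" if "r \<le> i" for i using that \<nu>(2) by (simp add: row_def)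
  show "top_gt (row \<nu>) \<in> gt r (row \<nu>)"
    using zero row_Suc_le[OF \<nu>(1)] by (auto simp: gt_def top_gt_def fun_eq_iff not_less)
  have sum: "(\<Sum>i<r. top_gt (row \<nu>) k i - j) = (\<Sum>i<k. row \<nu> i - j)" if "k \<le> r" for k j
  proof -
    have "(\<Sum>i<r. top_gt (row \<nu>) k i - j) = (\<Sum>i<k. top_gt (row \<nu>) k i - j)"
      by (rule sum.mono_neutral_right) (use that in \<open>auto simp: top_gt_def\<close>)
    then show ?thesis by (simp add: top_gt_def)
  qed
  show "good r (\<lambda>_. 0) (top_gt (row \<nu>))"
  proof (unfold good_def, safe)
    fix j u assume viol: "viol r (\<lambda>_. 0) (top_gt (row \<nu>)) j u"
    then have "Suc u < r" by (simp add: viol_def)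
    then show False
      using viol row_Suc_le[OF \<nu>(1), of u] sum[of u j] sum[of "Suc u" j] sum[of "Suc (Suc u)" j]
      by (simp add: viol_def tail_def)
  qed
  assume "v \<in> {1..r}"
  then show "wt r (top_gt (row \<nu>)) v = row \<nu> (v - 1)"
    using sum[of v 0] sum[of "v - 1" 0] by (cases v) (simp_all add: wt_def)
qed

text \<open>The bialternant formula: \<open>top_gt\<close> is the only pattern that is good for the weight 0.\<close>

lemma altd_zero_times_schur:
  assumes \<nu>: "young_diagram \<nu>" "length \<nu> \<le> r"
  shows "altd r (\<lambda>_. 0) * schur r \<nu> = altd r (\<lambda>v. row \<nu> (v - 1))"
proof -
  have uniq: "G = top_gt (row \<nu>)" if G: "G \<in> gt r (row \<nu>)" and good: "good r (\<lambda>_. 0) G" for G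
  proof (rule ext, rule ext)
    fix k i
    show "G k i = top_gt (row \<nu>) k i"
    proof (cases "i < k")
      case False then show ?thesis using gt_zero[OF G] by (simp add: top_gt_def)
    next
      case True
      have "G k i = row \<nu> i"
      proof (cases "i < r")
        case True
        have "G (Suc i) i \<le> G k i" by (rule gt_mono[OF G]) (use \<open>i < k\<close> in simp)
        moreover have "G k i \<le> G (max k r) i" by (rule gt_mono[OF G]) simp
        ultimately show ?thesis using good_zero_row[OF G good True] gt_D(2)[OF G, of "max k r"] by simp
      next
        case False
        then show ?thesis using gt_zero_r[OF G, of i k] \<nu>(2) by (simp add: row_def)
      qed
      then show ?thesis using True by (simp add: top_gt_def)
    qed
  qed
  have "{G \<in> gt r (row \<nu>). good r (\<lambda>_. 0) G} = {top_gt (row \<nu>)}"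
    using uniq top_gt_good[OF \<nu>] by blast
  moreover have "dominant r (\<lambda>_. 0)" by (simp add: dominant_def)
  ultimately have "altd r (\<lambda>_. 0) * schur r \<nu> = altd r (\<lambda>v. 0 + wt r (top_gt (row \<nu>)) v)"
    using altd_times_schur[OF _ \<nu>, of "\<lambda>_. 0"] by simp
  also have "\<dots> = altd r (\<lambda>v. row \<nu> (v - 1))"
    by (rule alt_cong) (use top_gt_good(3)[OF \<nu>] in simp)
  finally show ?thesis .
qed

section \<open>Superposition of columns\<close>

lemma partial_row_sum_le_tail:
  assumes G: "G \<in> gt r m"
  shows "(\<Sum>i<n. G k i) \<le> tail r G j k + j * n"
proof -
  have "(\<Sum>i<n. G k i) \<le> (\<Sum>i<n. (G k i - j) + j)" by (rule sum_mono) simp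
  also have "\<dots> = (\<Sum>i<n. G k i - j) + j * n" by (simp add: sum.distrib)
  also have "(\<Sum>i<n. G k i - j) \<le> (\<Sum>i<max n r. G k i - j)" by (rule sum_mono2) auto
  also have "(\<Sum>i<max n r. G k i - j) = tail r G j k"
    unfolding tail_def by (rule sum.mono_neutral_right) (auto simp: gt_zero_r[OF G])
  finally show ?thesis by simp
qed

lemma partial_row_sum_height:
  assumes G: "G \<in> gt r m"
  shows "(\<Sum>i<height r G j k. G k i) = tail r G j k + j * height r G j k"
proof -
  have S: "{i. i < r \<and> j < G k i} = {..<height r G j k}"
    unfolding height_def
    by (rule down_closed_eq_lessThan) (use gt_antimono_row[OF G, of k] in \<open>auto intro: less_le_trans\<close>)
  have "tail r G j k = (\<Sum>i\<in>{i. i < r \<and> j < G k i}. G k i - j)"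
    unfolding tail_def by (rule sum.mono_neutral_right) auto
  moreover have "(\<Sum>i\<in>{i. i < r \<and> j < G k i}. G k i) = (\<Sum>i\<in>{i. i < r \<and> j < G k i}. (G k i - j) + j)"
    by (rule sum.cong) auto
  ultimately show ?thesis by (simp add: S sum.distrib)
qed

text \<open>The hypothesis is goodness read row by row: weight plus the entries \<open>u + 1\<close> of the first \<open>n\<close> rows
  is at least weight plus the entries \<open>u + 2\<close> of the first \<open>n + 1\<close> rows. By the two previous lemmas
  a tail is the maximum over \<open>n\<close> of the sum of the first \<open>n\<close> entries of the level minus \<open>j n\<close>, attained
  at the height of column \<open>j\<close>. The heights \<open>B\<close> and \<open>A\<close> at the two outer levels differ by at most
  two, and in each case one row inequality bounds both maxima.\<close>

lemma row_good_imp_good: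
  assumes G: "G \<in> gt r m"
    and rows: "\<And>u n. Suc u < r \<Longrightarrow> \<kappa> (Suc (Suc u)) + (\<Sum>i<Suc n. G (Suc (Suc u)) i) + (\<Sum>i<n. G u i)
      \<le> \<kappa> (Suc u) + (\<Sum>i<n. G (Suc u) i) + (\<Sum>i<Suc n. G (Suc u) i)"
  shows "good r \<kappa> G"
  unfolding good_def
proof safe
  fix j u assume viol: "viol r \<kappa> G j u"
  then have u: "Suc u < r" by (simp add: viol_def)
  define A where "A = height r G j (Suc (Suc u))"
  define B where "B = height r G j u"
  have bounds: "B \<le> A" "A \<le> Suc (Suc B)"
    using height_bounds[OF G, of j u] height_bounds[OF G, of j "Suc u"] by (auto simp: A_def B_def)
  have A: "(\<Sum>i<A. G (Suc (Suc u)) i) = tail r G j (Suc (Suc u)) + j * A"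
    and B: "(\<Sum>i<B. G u i) = tail r G j u + j * B"
    using partial_row_sum_height[OF G] by (auto simp: A_def B_def)
  note le = partial_row_sum_le_tail[OF G, of "Suc u" _ j]
  have "\<kappa> (Suc (Suc u)) + tail r G j (Suc (Suc u)) + tail r G j u \<le> \<kappa> (Suc u) + 2 * tail r G j (Suc u)"
  proof -
    consider "A = B" | "A = Suc B" | "A = Suc (Suc B)" using bounds by linarith
    then show ?thesis
    proof cases
      case 1
      then show ?thesis using rows[OF u, of B] le[of B] A B gt_D(3)[OF G, of "Suc u" B] by simp
    next
      case 2
      then show ?thesis using rows[OF u, of B] le[of B] le[of "Suc B"] A B by simp
    next
      case 3
      have "G (Suc u) (Suc B) \<le> G u B" by (rule gt_D(4)[OF G])
      then show ?thesis using rows[OF u, of "Suc B"] le[of "Suc B"] A B 3 by simp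
    qed
  qed
  then show False using viol by (simp add: viol_def)
qed

text \<open>The superposition of the one-column tableaux with entry sets \<open>S c\<close>: row \<open>i\<close> receives from every
  \<open>c\<close> the entry of \<open>S c\<close> that has \<open>i\<close> smaller ones.\<close>

definition strips :: "'c set \<Rightarrow> ('c \<Rightarrow> nat set) \<Rightarrow> nat \<Rightarrow> nat \<Rightarrow> nat" where
  "strips C S k i = card {c \<in> C. i < card (S c \<inter> {..k})}"

lemma card_Int_atMost_Suc:
  "card (S \<inter> {..Suc k}) = card (S \<inter> {..k}) + (if Suc k \<in> S then 1 else 0)"
proof -
  have "S \<inter> {..Suc k} = (if Suc k \<in> S then insert (Suc k) (S \<inter> {..k}) else S \<inter> {..k})"
    by (auto simp: le_Suc_eq)
  then show ?thesis by simp
qed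

lemma strips_gt:
  assumes fin: "finite C" and S: "\<And>c. c \<in> C \<Longrightarrow> S c \<subseteq> {1..r}"
  shows "strips C S \<in> gt r (\<lambda>i. card {c \<in> C. i < card (S c)})"
  unfolding gt_def
proof (intro CollectI conjI allI impI)
  have "S c \<inter> {..0} = {}" if "c \<in> C" for c using S[OF that] by auto
  then have "{c \<in> C. i < card (S c \<inter> {..0})} = {}" for i by auto
  then show "strips C S 0 = (\<lambda>_. 0)" by (intro ext) (simp only: strips_def card.empty)
  show "strips C S k = (\<lambda>i. card {c \<in> C. i < card (S c)})" if "r \<le> k" for k
  proof -
    have "S c \<inter> {..k} = S c" if "c \<in> C" for c using S[OF that] \<open>r \<le> k\<close> by auto
    then show ?thesis by (auto simp: strips_def fun_eq_iff intro!: arg_cong[of _ _ card])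
  qed
  show "strips C S k i \<le> strips C S (Suc k) i" for k i
    unfolding strips_def by (rule card_mono) (auto simp: fin card_Int_atMost_Suc)
  show "strips C S (Suc k) (Suc i) \<le> strips C S k i" for k i
    unfolding strips_def by (rule card_mono) (auto simp: fin card_Int_atMost_Suc split: if_splits)
qed

lemma strips_partial_row_sum:
  assumes fin: "finite C"
  shows "(\<Sum>i<n. strips C S k i) = (\<Sum>c\<in>C. min n (card (S c \<inter> {..k})))"
proof -
  have "(\<Sum>i<n. strips C S k i) = (\<Sum>i<n. \<Sum>c\<in>C. if i < card (S c \<inter> {..k}) then 1 else 0)"
    by (simp add: strips_def sum.If_cases fin Int_def)
  also have "\<dots> = (\<Sum>c\<in>C. \<Sum>i<n. if i < card (S c \<inter> {..k}) then 1 else 0)" by (rule sum.swap)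
  also have "\<dots> = (\<Sum>c\<in>C. min n (card (S c \<inter> {..k})))"
  proof (rule sum.cong[OF refl])
    fix c
    have "{..<n} \<inter> {i. i < card (S c \<inter> {..k})} = {..<min n (card (S c \<inter> {..k}))}" by auto
    then show "(\<Sum>i<n. if i < card (S c \<inter> {..k}) then 1 else 0) = min n (card (S c \<inter> {..k}))"
      by (simp add: sum.If_cases)
  qed
  finally show ?thesis .
qed

lemma wt_strips:
  assumes fin: "finite C" and S: "\<And>c. c \<in> C \<Longrightarrow> S c \<subseteq> {1..r}"
    and "v \<in> {1..r}"
  shows "wt r (strips C S) v = (\<Sum>c\<in>C. if v \<in> S c then 1 else 0)"
proof -
  obtain u where u: "v = Suc u" using \<open>v \<in> {1..r}\<close> by (cases v) auto
  have "card (S c \<inter> {..k}) \<le> r" if "c \<in> C" for c k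
    using card_mono[of "{1..r}" "S c \<inter> {..k}"] S[OF that] by auto
  then have "(\<Sum>i<r. strips C S k i) = (\<Sum>c\<in>C. card (S c \<inter> {..k}))" for k
    unfolding strips_partial_row_sum[OF fin] by (intro sum.cong) (auto simp: min_absorb2)
  then show ?thesis by (simp add: wt_def u card_Int_atMost_Suc sum.distrib)
qed

text \<open>The partial sums over the rows are additive in \<open>c\<close>, so the row criterion may be checked for a single
  column. There it holds once the weights before and after adding the column are both weakly
  decreasing.\<close>

lemma strips_good:
  assumes fin: "finite C" and S: "\<And>c. c \<in> C \<Longrightarrow> S c \<subseteq> {1..r}"
    and old: "\<And>c. c \<in> C \<Longrightarrow> dominant r (\<kappa> c)"
    and new: "\<And>c. c \<in> C \<Longrightarrow> dominant r (\<lambda>v. \<kappa> c v + (if v \<in> S c then 1 else 0))"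
  shows "good r (\<lambda>v. \<Sum>c\<in>C. \<kappa> c v) (strips C S)"
proof (rule row_good_imp_good[OF strips_gt[OF fin S]])
  fix u n assume u: "Suc u < r"
  show "(\<Sum>c\<in>C. \<kappa> c (Suc (Suc u))) + (\<Sum>i<Suc n. strips C S (Suc (Suc u)) i) + (\<Sum>i<n. strips C S u i)
    \<le> (\<Sum>c\<in>C. \<kappa> c (Suc u)) + (\<Sum>i<n. strips C S (Suc u) i) + (\<Sum>i<Suc n. strips C S (Suc u) i)"
    unfolding strips_partial_row_sum[OF fin] sum.distrib[symmetric]
  proof (rule sum_mono)
    fix c assume c: "c \<in> C"
    have "\<kappa> c (Suc (Suc u)) \<le> \<kappa> c (Suc u)"
      "\<kappa> c (Suc (Suc u)) + (if Suc (Suc u) \<in> S c then 1 else 0) \<le> \<kappa> c (Suc u) + (if Suc u \<in> S c then 1 else 0)"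
      using old[OF c] new[OF c] u unfolding dominant_def by blast+
    then show "\<kappa> c (Suc (Suc u)) + min (Suc n) (card (S c \<inter> {..Suc (Suc u)})) + min n (card (S c \<inter> {..u}))
      \<le> \<kappa> c (Suc u) + min n (card (S c \<inter> {..Suc u})) + min (Suc n) (card (S c \<inter> {..Suc u}))"
      unfolding card_Int_atMost_Suc by (cases "Suc u \<in> S c"; cases "Suc (Suc u) \<in> S c") simp_all
  qed
qed

section \<open>Balanced weights\<close>

text \<open>Hermite's identity for an integer: raising \<open>n\<close> by one replaces the term \<open>n div r\<close> of the sum by
  \<open>(n + r) div r\<close>.\<close>

lemma sum_shifted_div:
  fixes n r :: nat
  assumes "0 < r"
  shows "(\<Sum>w<r. (n + w) div r) = n"
proof (induction n)
  case 0
  have "(\<Sum>w<r. (0 + w) div r) = (\<Sum>w<r. 0)" by (rule sum.cong) auto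
  then show ?case by simp
next
  case (Suc n)
  obtain r' where r: "r = Suc r'" using assms by (cases r) auto
  have "(\<Sum>w<r. (Suc n + w) div r) + n div r = (\<Sum>w<Suc r. (n + w) div r)"
    unfolding sum.lessThan_Suc_shift by simp
  also have "\<dots> = n + (n + r) div r" using Suc.IH by simp
  also have "(n + r) div r = Suc (n div r)" using assms by simp
  finally show ?case by simp
qed

text \<open>The distribution of \<open>n\<close> units over the places \<open>1, \<dots>, r\<close> in which the entries differ by at most one
  and the larger ones come first. The set \<open>window\<close> below collects the places that grow when the number of
  units rises from \<open>k h\<close> to \<open>(k + 1) h\<close>.\<close>

definition balanced :: "nat \<Rightarrow> nat \<Rightarrow> nat \<Rightarrow> nat" where
  "balanced r n v = (n + r - v) div r"

lemma sum_balanced: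
  assumes "0 < r" shows "(\<Sum>v\<in>{1..r}. balanced r n v) = n"
proof -
  have "(\<Sum>v\<in>{1..r}. balanced r n v) = (\<Sum>w<r. (n + w) div r)"
    unfolding balanced_def
    by (rule sum.reindex_bij_witness[of _ "\<lambda>w. r - w" "\<lambda>v. r - v"]) auto
  then show ?thesis using sum_shifted_div[OF assms] by simp
qed

lemma dominant_balanced: "dominant r (balanced r n)"
  unfolding dominant_def balanced_def by (intro allI impI div_le_mono) simp

definition window :: "nat \<Rightarrow> nat \<Rightarrow> nat \<Rightarrow> nat set" where
  "window r h k = {v \<in> {1..r}. balanced r (Suc k * h) v \<noteq> balanced r (k * h) v}"

lemma balanced_step:
  assumes "h \<le> r" "v \<in> {1..r}"
  shows "balanced r (Suc k * h) v = balanced r (k * h) v + (if v \<in> window r h k then 1 else 0)"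
proof -
  let ?x = "k * h + r - v"
  have r: "0 < r" using assms(2) by simp
  have "balanced r (Suc k * h) v = (?x + h) div r"
  proof -
    have "Suc k * h + r - v = ?x + h" using assms(2) by simp
    then show ?thesis by (simp only: balanced_def)
  qed
  moreover have "balanced r (k * h) v = ?x div r" by (simp only: balanced_def)
  moreover have "?x div r \<le> (?x + h) div r" by (rule div_le_mono) simp
  moreover have "(?x + h) div r \<le> (?x + r) div r" by (rule div_le_mono) (use assms(1) in simp)
  moreover have "(?x + r) div r = Suc (?x div r)" using r by simp
  ultimately have "balanced r (k * h) v \<le> balanced r (Suc k * h) v"
    "balanced r (Suc k * h) v \<le> Suc (balanced r (k * h) v)" by linarith+
  moreover have "v \<in> window r h k \<longleftrightarrow> balanced r (Suc k * h) v \<noteq> balanced r (k * h) v"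
    using assms(2) by (simp only: window_def mem_Collect_eq simp_thms)
  ultimately show ?thesis by (cases "v \<in> window r h k") simp_all
qed

lemma card_window:
  assumes "0 < r" "h \<le> r" shows "card (window r h k) = h"
proof -
  have "Suc k * h = (\<Sum>v\<in>{1..r}. balanced r (k * h) v + (if v \<in> window r h k then 1 else 0))"
    using sum_balanced[OF assms(1), of "Suc k * h"] balanced_step[OF assms(2)] by simp
  also have "\<dots> = k * h + card ({1..r} \<inter> window r h k)"
    using sum_balanced[OF assms(1), of "k * h"] by (simp add: sum.distrib sum.If_cases Int_def)
  also have "{1..r} \<inter> window r h k = window r h k" by (auto simp: window_def)
  finally show ?thesis by simp
qed

section \<open>Schur expansions of products\<close>

lemma good_cong:
  assumes "\<And>v. v \<in> {1..r} \<Longrightarrow> \<kappa> v = \<kappa>' v"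
  shows "good r \<kappa> G \<longleftrightarrow> good r \<kappa>' G"
proof -
  have "viol r \<kappa> G j u \<longleftrightarrow> viol r \<kappa>' G j u" for j u
    using assms[of "Suc u"] assms[of "Suc (Suc u)"] by (auto simp: viol_def)
  then show ?thesis by (simp add: good_def)
qed

text \<open>Alternant expansions are carried along as multisets of weights, so that nonnegativity of the
  coefficients is built in. The last conjunct lets a chain of good patterns be followed through
  the successive factors.\<close>

lemma expand_times_schur:
  assumes \<nu>: "young_diagram \<nu>" "length \<nu> \<le> r" and M: "\<forall>\<alpha>\<in>#M. dominant r \<alpha>"
  shows "\<exists>M'. (\<forall>\<beta>\<in>#M'. dominant r \<beta>) \<and>
    (\<Sum>\<beta>\<in>#M'. altd r \<beta>) = (\<Sum>\<alpha>\<in>#M. altd r \<alpha>) * schur r \<nu> \<and>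
    (\<forall>\<alpha>\<in>#M. \<forall>G\<in>gt r (row \<nu>). good r \<alpha> G \<longrightarrow> (\<lambda>v. \<alpha> v + wt r G v) \<in># M')"
  using M
proof (induction M)
  case empty
  show ?case by (rule exI[of _ "{#}"]) simp
next
  case (add \<alpha> M)
  then obtain M' where M': "\<forall>\<beta>\<in>#M'. dominant r \<beta>"
    "(\<Sum>\<beta>\<in>#M'. altd r \<beta>) = (\<Sum>\<alpha>\<in>#M. altd r \<alpha>) * schur r \<nu>"
    "\<forall>\<alpha>\<in>#M. \<forall>G\<in>gt r (row \<nu>). good r \<alpha> G \<longrightarrow> (\<lambda>v. \<alpha> v + wt r G v) \<in># M'" by auto
  let ?X = "{G. G \<in> gt r (row \<nu>) \<and> good r \<alpha> G}"
  let ?N = "image_mset (\<lambda>G v. \<alpha> v + wt r G v) (mset_set ?X)"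
  have fin: "finite ?X" using finite_gt[OF \<nu>(1)] by simp
  have "(\<Sum>\<beta>\<in>#?N. altd r \<beta>) = (\<Sum>G\<in>?X. altd r (\<lambda>v. \<alpha> v + wt r G v))"
    by (simp add: sum_unfold_sum_mset image_mset.compositionality o_def)
  also have "\<dots> = altd r \<alpha> * schur r \<nu>"
    using altd_times_schur[OF _ \<nu>, of \<alpha>] add.prems by simp
  finally have "(\<Sum>\<beta>\<in>#?N + M'. altd r \<beta>) = (\<Sum>\<alpha>\<in>#add_mset \<alpha> M. altd r \<alpha>) * schur r \<nu>"
    using M'(2) by (simp add: distrib_right)
  moreover have "\<forall>\<beta>\<in>#?N + M'. dominant r \<beta>" using M'(1) good_dominant fin by auto
  moreover have "\<forall>\<alpha>'\<in>#add_mset \<alpha> M. \<forall>G\<in>gt r (row \<nu>). good r \<alpha>' G \<longrightarrow> (\<lambda>v. \<alpha>' v + wt r G v) \<in># ?N + M'"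
    using M'(3) fin by auto
  ultimately show ?case by blast
qed

lemma row_pos_iff: "young_diagram \<nu> \<Longrightarrow> 0 < row \<nu> i \<longleftrightarrow> i < length \<nu>"
  by (auto simp: row_def young_diagram_def)

lemma young_diagram_eqI:
  assumes "young_diagram \<nu>" "length \<nu> \<le> r" "young_diagram \<nu>'" "length \<nu>' \<le> r"
    and eq: "\<forall>v\<in>{1..r}. row \<nu> (v - 1) = row \<nu>' (v - 1)"
  shows "\<nu> = \<nu>'"
proof -
  have row: "row \<nu> i = row \<nu>' i" for i
  proof (cases "i < r")
    case True then show ?thesis using bspec[OF eq, of "Suc i"] by simp
  next
    case False then show ?thesis using assms(2,4) by (simp add: row_def)
  qed
  have "i < length \<nu> \<longleftrightarrow> i < length \<nu>'" for i
    using row_pos_iff[OF assms(1), of i] row_pos_iff[OF assms(3), of i] row[of i] by simp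
  then have len: "length \<nu> = length \<nu>'" by (meson linorder_neqE_nat less_irrefl)
  then show ?thesis
  proof (rule nth_equalityI)
    fix i assume "i < length \<nu>"
    then show "\<nu> ! i = \<nu>' ! i" using row[of i] len by (simp add: row_def)
  qed
qed

lemma dominant_row: "young_diagram \<nu> \<Longrightarrow> dominant r (\<lambda>v. row \<nu> (v - 1))"
  unfolding dominant_def
proof (intro allI impI)
  fix v assume \<nu>: "young_diagram \<nu>" and "0 < v \<and> v < r"
  then show "row \<nu> (Suc v - 1) \<le> row \<nu> (v - 1)" using row_Suc_le[OF \<nu>, of "v - 1"] by simp
qed

text \<open>The coefficients of any Schur expansion are determined by the polynomial: multiplication by \<open>a(\<delta>)\<close>
  turns it into an alternant expansion.\<close>

lemma schur_expansion_coeff: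
  assumes c: "schur_expansion r p c" and \<nu>: "young_diagram \<nu>" "length \<nu> \<le> r"
  shows "c \<nu> = Poly_Mapping.lookup (altd r (\<lambda>_. 0) * p) (expo r (\<lambda>v. row \<nu> (v - 1) + stair r v))"
proof -
  let ?N = "{\<nu>. c \<nu> \<noteq> 0}"
  have fin: "finite ?N" and young: "\<And>\<nu>'. \<nu>' \<in> ?N \<Longrightarrow> young_diagram \<nu>' \<and> length \<nu>' \<le> r"
    and p: "p = (\<Sum>\<nu>'\<in>?N. of_int (c \<nu>') * schur r \<nu>')"
    using c by (auto simp: schur_expansion_def)
  have "altd r (\<lambda>_. 0) * p = (\<Sum>\<nu>'\<in>?N. of_int (c \<nu>') * (altd r (\<lambda>_. 0) * schur r \<nu>'))"
    unfolding p sum_distrib_left by (simp add: ac_simps)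
  also have "\<dots> = (\<Sum>\<nu>'\<in>?N. of_int (c \<nu>') * altd r (\<lambda>v. row \<nu>' (v - 1)))"
    by (rule sum.cong[OF refl]) (use young altd_zero_times_schur in simp)
  finally have "Poly_Mapping.lookup (altd r (\<lambda>_. 0) * p) (expo r (\<lambda>v. row \<nu> (v - 1) + stair r v)) =
      (\<Sum>\<nu>'\<in>?N. c \<nu>' * Poly_Mapping.lookup (altd r (\<lambda>v. row \<nu>' (v - 1))) (expo r (\<lambda>v. row \<nu> (v - 1) + stair r v)))"
    by (simp only: lookup_sum lookup_of_int_times)
  also have "\<dots> = (\<Sum>\<nu>'\<in>?N. if \<nu>' = \<nu> then c \<nu>' else 0)"
  proof (rule sum.cong[OF refl])
    fix \<nu>' assume "\<nu>' \<in> ?N"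
    then have \<nu>': "young_diagram \<nu>'" "length \<nu>' \<le> r" using young by auto
    show "c \<nu>' * Poly_Mapping.lookup (altd r (\<lambda>v. row \<nu>' (v - 1))) (expo r (\<lambda>v. row \<nu> (v - 1) + stair r v))
      = (if \<nu>' = \<nu> then c \<nu>' else 0)"
      using young_diagram_eqI[OF \<nu>' \<nu>]
      by (auto simp: lookup_altd[OF dominant_row[OF \<nu>'(1)] dominant_row[OF \<nu>(1)]] simp del: One_nat_def)
  qed
  also have "\<dots> = c \<nu>" using fin by simp
  finally show ?thesis by simp
qed

lemma schur_expansion_unique:
  assumes "schur_expansion r p c" "schur_expansion r p c'"
  shows "c = c'"
proof
  fix \<nu>
  show "c \<nu> = c' \<nu>"
  proof (cases "young_diagram \<nu> \<and> length \<nu> \<le> r")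
    case True
    then show ?thesis using schur_expansion_coeff[OF assms(1)] schur_expansion_coeff[OF assms(2)] by simp
  next
    case False
    then have "c \<nu> = 0" "c' \<nu> = 0" using assms unfolding schur_expansion_def by blast+
    then show ?thesis by simp
  qed
qed

text \<open>The Young diagram whose row lengths are the nonzero entries of a weakly decreasing weight.\<close>

definition diag :: "nat \<Rightarrow> (nat \<Rightarrow> nat) \<Rightarrow> nat list" where
  "diag r \<alpha> = map (\<lambda>i. \<alpha> (Suc i)) [0..<card {i. i < r \<and> 0 < \<alpha> (Suc i)}]"

lemma diag:
  assumes \<alpha>: "dominant r \<alpha>"
  shows "young_diagram (diag r \<alpha>)" "length (diag r \<alpha>) \<le> r"
    "v \<in> {1..r} \<Longrightarrow> row (diag r \<alpha>) (v - 1) = \<alpha> v"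
proof -
  define l where "l = card {i. i < r \<and> 0 < \<alpha> (Suc i)}"
  have d: "diag r \<alpha> = map (\<lambda>i. \<alpha> (Suc i)) [0..<l]" by (simp add: diag_def l_def)
  have "{i. i < r \<and> 0 < \<alpha> (Suc i)} = {..<l}"
    unfolding l_def
    by (rule down_closed_eq_lessThan) (use \<alpha> in \<open>fastforce simp: dominant_def\<close>)+
  then have iff: "i < l \<longleftrightarrow> i < r \<and> 0 < \<alpha> (Suc i)" for i by auto
  have "\<alpha> (Suc j) \<le> \<alpha> (Suc i)" if "i < j" "j < l" for i j
    by (rule dominant_le[OF \<alpha>]) (use that iff[of j] in auto)
  moreover have "0 < x" if x: "x \<in> set (diag r \<alpha>)" for x
  proof -
    obtain i where "i < l" "x = \<alpha> (Suc i)" using x by (auto simp: d)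
    then show ?thesis using iff[of i] by simp
  qed
  ultimately show "young_diagram (diag r \<alpha>)"
    by (simp add: young_diagram_def d sorted_wrt_iff_nth_less)
  show "length (diag r \<alpha>) \<le> r" using iff[of r] by (simp add: d)
  assume "v \<in> {1..r}"
  then show "row (diag r \<alpha>) (v - 1) = \<alpha> v" using iff[of "v - 1"] by (cases v) (auto simp: row_def d)
qed

lemma sum_mset_eq_sum_count:
  fixes f :: "'a \<Rightarrow> 'b::comm_semiring_1"
  assumes "finite A" "set_mset N \<subseteq> A"
  shows "(\<Sum>x\<in>#N. f x) = (\<Sum>x\<in>A. of_nat (count N x) * f x)"
  using assms(2)
proof (induction N)
  case (add a N)
  have "(\<Sum>x\<in>A. of_nat (count (add_mset a N) x) * f x) =
      (\<Sum>x\<in>A. of_nat (count N x) * f x + (if x = a then f x else 0))"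
    by (rule sum.cong) (auto simp: algebra_simps)
  also have "\<dots> = (\<Sum>x\<in>A. of_nat (count N x) * f x) + f a"
    using add.prems assms(1) by (simp add: sum.distrib)
  finally show ?case using add by (simp add: add.commute)
qed simp

text \<open>Cancelling \<open>a(\<delta>)\<close> turns an alternant expansion back into a Schur expansion, with multiplicities as
  coefficients.\<close>

lemma schur_expansion_of_altd_sum:
  assumes M: "\<forall>\<alpha>\<in>#M. dominant r \<alpha>" and p: "altd r (\<lambda>_. 0) * p = (\<Sum>\<alpha>\<in>#M. altd r \<alpha>)"
  shows "schur_expansion r p (\<lambda>\<nu>. int (count (image_mset (diag r) M) \<nu>))"
proof -
  let ?N = "image_mset (diag r) M"
  have "(\<Sum>\<alpha>\<in>#M. altd r \<alpha>) = (\<Sum>\<alpha>\<in>#M. altd r (\<lambda>_. 0) * schur r (diag r \<alpha>))"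
  proof (rule arg_cong[of _ _ sum_mset], rule image_mset_cong)
    fix \<alpha> assume "\<alpha> \<in># M"
    then have \<alpha>: "dominant r \<alpha>" using M by blast
    have "altd r \<alpha> = altd r (\<lambda>v. row (diag r \<alpha>) (v - 1))"
      by (rule alt_cong) (simp only: diag(3)[OF \<alpha>])
    then show "altd r \<alpha> = altd r (\<lambda>_. 0) * schur r (diag r \<alpha>)"
      by (simp only: altd_zero_times_schur[OF diag(1,2)[OF \<alpha>]])
  qed
  with p have "altd r (\<lambda>_. 0) * p = (\<Sum>\<alpha>\<in>#M. altd r (\<lambda>_. 0) * schur r (diag r \<alpha>))"
    by (rule trans)
  then have "altd r (\<lambda>_. 0) * p = altd r (\<lambda>_. 0) * (\<Sum>\<nu>\<in>#?N. schur r \<nu>)"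
    by (simp only: sum_mset_distrib_left image_mset.compositionality o_def)
  then have "p = (\<Sum>\<nu>\<in>#?N. schur r \<nu>)"
    using altd_zero_nonzero[of r] by (simp only: mult_cancel_left) simp
  also have "\<dots> = (\<Sum>\<nu>\<in>set_mset ?N. of_int (int (count ?N \<nu>)) * schur r \<nu>)"
    by (simp only: of_int_of_nat_eq) (rule sum_mset_eq_sum_count, simp_all)
  finally have "p = (\<Sum>\<nu>\<in>set_mset ?N. of_int (int (count ?N \<nu>)) * schur r \<nu>)" .
  moreover have support: "{\<nu>. int (count ?N \<nu>) \<noteq> 0} = set_mset ?N"
    by (rule set_eqI) (simp only: mem_Collect_eq of_nat_eq_0_iff count_eq_zero_iff not_not)
  moreover have "\<forall>\<nu>\<in>#?N. young_diagram \<nu> \<and> length \<nu> \<le> r" using M diag(1,2) by auto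
  then have "\<forall>\<nu>. int (count ?N \<nu>) \<noteq> 0 \<longrightarrow> young_diagram \<nu> \<and> length \<nu> \<le> r"
    using support by blast
  ultimately show ?thesis unfolding schur_expansion_def by (simp only: finite_set_mset)
qed

section \<open>The rectangle\<close>

lemma young_dual:
  assumes "\<sigma> \<in> H r"
  shows "young_diagram (young_dual \<sigma>)" "length (young_dual \<sigma>) \<le> r"
    "row (young_dual \<sigma>) i = card {c. c < length \<sigma> \<and> i < \<sigma> ! c}"
proof -
  have \<sigma>: "young_diagram \<sigma>" "num_cols \<sigma> \<le> r" using assms by (auto simp: H_def)
  have nth: "young_dual \<sigma> ! i = card {c. c < length \<sigma> \<and> i < \<sigma> ! c}" if "i < num_cols \<sigma>" for i
    using that by (simp add: young_dual_def Suc_le_eq del: upt_Suc)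
  have len: "length (young_dual \<sigma>) = num_cols \<sigma>" by (simp add: young_dual_def)
  show "length (young_dual \<sigma>) \<le> r" using \<sigma>(2) len by simp
  have "\<sigma> ! c \<le> num_cols \<sigma>" if "c < length \<sigma>" for c
    using \<sigma>(1) that by (cases \<sigma>; cases c) (auto simp: young_diagram_def num_cols_def)
  then have "\<not> i < \<sigma> ! c" if "c < length \<sigma>" "num_cols \<sigma> \<le> i" for c i
    using that by (meson leD le_less_trans less_le_trans)
  then have empty: "{c. c < length \<sigma> \<and> i < \<sigma> ! c} = {}" if "num_cols \<sigma> \<le> i" for i
    using that by blast
  show "row (young_dual \<sigma>) i = card {c. c < length \<sigma> \<and> i < \<sigma> ! c}"
    using nth[of i] empty[of i] len by (cases "i < num_cols \<sigma>") (simp_all add: row_def)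
  have "young_dual \<sigma> ! j \<le> young_dual \<sigma> ! i" if "i < j" "j < num_cols \<sigma>" for i j
    using that nth[of i] nth[of j] by (auto intro!: card_mono)
  moreover have "0 < young_dual \<sigma> ! i" if "i < num_cols \<sigma>" for i
  proof -
    have "0 \<in> {c. c < length \<sigma> \<and> i < \<sigma> ! c}" using that by (cases \<sigma>) (auto simp: num_cols_def)
    then show ?thesis using nth[OF that] by (auto simp: card_gt_0_iff)
  qed
  ultimately show "young_diagram (young_dual \<sigma>)"
    by (auto simp: young_diagram_def sorted_wrt_iff_nth_less len in_set_conv_nth)
qed

theorem theoremA2:
  fixes r l :: nat and \<sigma> \<rho> :: "nat list"
  assumes "0 < r" and "\<sigma> \<in> H r" and "l = sum_list \<sigma>" and "\<rho> = rect r l"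
  shows "0 < lr_coeff r (replicate r (young_dual \<sigma>)) (young_dual \<rho>)"
proof -
  note r = \<open>0 < r\<close>
  let ?\<mu> = "young_dual \<sigma>" and ?C = "{..<length \<sigma>}"
  note \<mu> = young_dual[OF \<open>\<sigma> \<in> H r\<close>]
  have h: "\<sigma> ! c \<le> r" if "c < length \<sigma>" for c
    using \<open>\<sigma> \<in> H r\<close> that
    by (cases \<sigma>; cases c) (auto simp: H_def young_diagram_def num_cols_def intro: order_trans)
  \<comment> \<open>The weight after \<open>k\<close> factors: the chains of the single columns, added up.\<close>
  define \<kappa> where "\<kappa> k v = (\<Sum>c\<in>?C. balanced r (k * \<sigma> ! c) v)" for k v
  define S where "S k c = window r (\<sigma> ! c) k" for k c
  have S: "S k c \<subseteq> {1..r}" for k c by (auto simp: S_def window_def)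
  have gt: "strips ?C (S k) \<in> gt r (row ?\<mu>)" for k
  proof -
    have "row ?\<mu> = (\<lambda>i. card {c \<in> ?C. i < card (S k c)})"
      using card_window[OF r h] by (auto simp: \<mu>(3) S_def fun_eq_iff intro!: arg_cong[of _ _ card])
    then show ?thesis using strips_gt[of ?C "S k" r] S by simp
  qed
  have good: "good r (\<kappa> k) (strips ?C (S k))" for k
    unfolding \<kappa>_def
  proof (rule strips_good)
    fix c assume "c \<in> ?C"
    then have h: "\<sigma> ! c \<le> r" using h by simp
    show "dominant r (\<lambda>v. balanced r (k * \<sigma> ! c) v + (if v \<in> S k c then 1 else 0))"
      using dominant_balanced[of r "Suc k * \<sigma> ! c"] balanced_step[OF h]
      by (simp add: dominant_def S_def)
  qed (use S dominant_balanced in auto)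
  have step: "\<kappa> (Suc k) v = \<kappa> k v + wt r (strips ?C (S k)) v" if v: "v \<in> {1..r}" for k v
  proof -
    have "wt r (strips ?C (S k)) v = (\<Sum>c\<in>?C. if v \<in> S k c then 1 else 0)"
      by (rule wt_strips[OF _ _ v]) (use S in auto)
    then show ?thesis
      using balanced_step[OF h v] by (simp add: \<kappa>_def S_def sum.distrib[symmetric])
  qed
  have "\<exists>M. (\<forall>\<alpha>\<in>#M. dominant r \<alpha>) \<and>
      altd r (\<lambda>_. 0) * (\<Prod>\<mu>\<leftarrow>replicate k ?\<mu>. schur r \<mu>) = (\<Sum>\<alpha>\<in>#M. altd r \<alpha>) \<and>
      (\<exists>\<alpha>\<in>#M. \<forall>v\<in>{1..r}. \<alpha> v = \<kappa> k v)" for k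
  proof (induction k)
    case 0
    show ?case
      by (rule exI[of _ "{#\<lambda>_. 0#}"]) (auto simp: dominant_def \<kappa>_def balanced_def)
  next
    case (Suc k)
    then obtain M \<alpha> where M: "\<forall>\<alpha>\<in>#M. dominant r \<alpha>"
      "altd r (\<lambda>_. 0) * (\<Prod>\<mu>\<leftarrow>replicate k ?\<mu>. schur r \<mu>) = (\<Sum>\<alpha>\<in>#M. altd r \<alpha>)"
      "\<alpha> \<in># M" "\<forall>v\<in>{1..r}. \<alpha> v = \<kappa> k v" by blast
    obtain M' where M': "\<forall>\<beta>\<in>#M'. dominant r \<beta>"
      "(\<Sum>\<beta>\<in>#M'. altd r \<beta>) = (\<Sum>\<alpha>\<in>#M. altd r \<alpha>) * schur r ?\<mu>"
      "\<forall>\<alpha>\<in>#M. \<forall>G\<in>gt r (row ?\<mu>). good r \<alpha> G \<longrightarrow> (\<lambda>v. \<alpha> v + wt r G v) \<in># M'"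
      using expand_times_schur[OF \<mu>(1,2) M(1)] by blast
    have "good r \<alpha> (strips ?C (S k))" using good_cong[of r \<alpha> "\<kappa> k"] good M(4) by blast
    then have "(\<lambda>v. \<alpha> v + wt r (strips ?C (S k)) v) \<in># M'" using M'(3) M(3) gt by blast
    moreover have "\<forall>v\<in>{1..r}. \<alpha> v + wt r (strips ?C (S k)) v = \<kappa> (Suc k) v" using step M(4) by simp
    moreover have "altd r (\<lambda>_. 0) * (\<Prod>\<mu>\<leftarrow>replicate (Suc k) ?\<mu>. schur r \<mu>) = (\<Sum>\<beta>\<in>#M'. altd r \<beta>)"
      using M'(2) M(2) by (simp add: ac_simps)
    ultimately show ?case using M'(1)
      by (intro exI[of _ M'] conjI bexI[of _ "\<lambda>v. \<alpha> v + wt r (strips ?C (S k)) v"])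
  qed
  from this[of r] obtain M \<alpha> where M: "\<forall>\<alpha>\<in>#M. dominant r \<alpha>"
    "altd r (\<lambda>_. 0) * (\<Prod>\<mu>\<leftarrow>replicate r ?\<mu>. schur r \<mu>) = (\<Sum>\<alpha>\<in>#M. altd r \<alpha>)"
    "\<alpha> \<in># M" "\<forall>v\<in>{1..r}. \<alpha> v = \<kappa> r v" by blast
  note exp = schur_expansion_of_altd_sum[OF M(1,2)]
  have lr: "lr_coeff r (replicate r ?\<mu>) = (\<lambda>\<nu>. int (count (image_mset (diag r) M) \<nu>))"
    unfolding lr_coeff_def by (rule the_equality[where P="schur_expansion r _", OF exp]) (rule schur_expansion_unique[OF _ exp])
  have "\<rho> \<in> H r" using \<open>\<rho> = rect r l\<close> r
    by (auto simp: H_def rect_def young_diagram_def num_cols_def sorted_wrt_iff_nth_less)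
  note \<rho> = young_dual[OF this]
  have "young_dual \<rho> = diag r \<alpha>"
  proof (rule young_diagram_eqI[OF \<rho>(1,2)])
    have \<alpha>: "dominant r \<alpha>" using M by blast
    show "young_diagram (diag r \<alpha>)" "length (diag r \<alpha>) \<le> r" using diag[OF \<alpha>] by auto
    show "\<forall>v\<in>{1..r}. row (young_dual \<rho>) (v - 1) = row (diag r \<alpha>) (v - 1)"
    proof
      fix v assume v: "v \<in> {1..r}"
      have "balanced r (r * n) v = n" for n
      proof -
        have "r * n + r - v = (r - v) + n * r" using v by (simp add: mult.commute)
        moreover have "(r - v) div r = 0" using v by simp
        ultimately show ?thesis using r by (simp only: balanced_def div_mult_self1)
      qed
      then have "\<kappa> r v = (\<Sum>c<length \<sigma>. \<sigma> ! c)" by (simp add: \<kappa>_def)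
      also have "\<dots> = l" using \<open>l = sum_list \<sigma>\<close> by (simp add: sum_list_sum_nth atLeast0LessThan)
      also have "l = row (young_dual \<rho>) (v - 1)"
      proof -
        have "{c. c < length \<rho> \<and> v - 1 < \<rho> ! c} = {..<l}"
          using v \<open>\<rho> = rect r l\<close> by (auto simp: rect_def)
        then show ?thesis using \<rho>(3)[of "v - 1"] by simp
      qed
      finally show "row (young_dual \<rho>) (v - 1) = row (diag r \<alpha>) (v - 1)"
        using diag(3)[OF \<alpha> v] M(4) v by simp
    qed
  qed
  then have "young_dual \<rho> \<in># image_mset (diag r) M" using M(3) by simp
  then show ?thesis by (simp add: lr)
qed

end
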